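(* Let $L$ be a bounded distributive lattice and $G$ the Gödel algebra free over $L$. Then $G$ is a bi-Heyting algebra iff $L$ is a co-Heyting algebra.
   Context: A Gödel algebra is a Heyting algebra with $(x\to y)\vee(y\to x)=1$. $G$ is free over $L$ via a lattice homomorphism $e\colon L\to G$ if for every Gödel algebra $H$ and lattice homomorphism $f\colon L\to H$ there is a unique Heyting homomorphism $g\colon G\to H$ with $g\circ e=f$. A co-Heyting algebra is a distributive lattice whose order dual is a Heyting algebra; a bi-Heyting algebra is a Heyting algebra that is also a co-Heyting algebra. *)

theory Defs
  imports "HOL-Algebra.Lattice" "HOL-Library.FuncSet"
begin

locale distributive_lattice = lattice +
  assumes meet_join_distrib:
    "\<lbrakk>x \<in> carrier L; y \<in> carrier L; z \<in> carrier L\<rbrakk> \<Longrightarrow> x \<sqinter> (y \<squnion> z) = (x \<sqinter> y) \<squnion> (x \<sqinter> z)"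

locale bounded_distributive_lattice = bounded_lattice + distributive_lattice

locale heyting_algebra = bounded_lattice +
  assumes imp_exists:
    "\<lbrakk>x \<in> carrier L; y \<in> carrier L\<rbrakk> \<Longrightarrow> \<exists>z. greatest L z {w \<in> carrier L. x \<sqinter> w \<sqsubseteq> y}"

definition heyting_imp :: "[_, 'a, 'a] \<Rightarrow> 'a" (infixr \<open>\<Rrightarrow>\<index>\<close> 60)
  where "x \<Rrightarrow>\<^bsub>L\<^esub> y = (THE z. greatest L z {w \<in> carrier L. x \<sqinter>\<^bsub>L\<^esub> w \<sqsubseteq>\<^bsub>L\<^esub> y})"

locale godel_algebra = heyting_algebra +
  assumes prelinear:
    "\<lbrakk>x \<in> carrier L; y \<in> carrier L\<rbrakk> \<Longrightarrow> (x \<Rrightarrow> y) \<squnion> (y \<Rrightarrow> x) = \<top>"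

locale co_heyting_algebra = distributive_lattice +
  assumes dual_heyting: "heyting_algebra (inv_gorder L)"

locale bi_heyting_algebra = heyting_algebra + co_heyting_algebra

text \<open>
  Homomorphisms of bounded distributive lattices preserve the bounds.
\<close>

definition lattice_homs :: "('a, 'c) gorder_scheme \<Rightarrow> ('b, 'd) gorder_scheme \<Rightarrow> ('a \<Rightarrow> 'b) set"
  where "lattice_homs L M =
    {f \<in> carrier L \<rightarrow> carrier M. join_pres L M f \<and> meet_pres L M f \<and>
      f \<bottom>\<^bsub>L\<^esub> = \<bottom>\<^bsub>M\<^esub> \<and> f \<top>\<^bsub>L\<^esub> = \<top>\<^bsub>M\<^esub>}"

definition heyting_homs :: "('a, 'c) gorder_scheme \<Rightarrow> ('b, 'd) gorder_scheme \<Rightarrow> ('a \<Rightarrow> 'b) set"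
  where "heyting_homs G H =
    {g \<in> lattice_homs G H. \<forall>x \<in> carrier G. \<forall>y \<in> carrier G. g (x \<Rrightarrow>\<^bsub>G\<^esub> y) = g x \<Rrightarrow>\<^bsub>H\<^esub> g y}"

text \<open>
  A formula cannot quantify over all types, so the algebras \<open>H\<close> of the universal property
  range over those with a carrier inside the infinite type \<^typ>\<open>('l + 'g) list\<close>, into
  which both \<^typ>\<open>'l\<close> and \<^typ>\<open>'g\<close> embed.  This is no restriction: the lemma
  \<open>free_godel_universal\<close> below derives the universal property for Goedel algebras on an
  arbitrary type.  Maps \<open>g\<close> are taken to be extensional since they matter only on the carrier.
\<close>

definition free_godel_algebra :: "'l gorder \<Rightarrow> 'g gorder \<Rightarrow> ('l \<Rightarrow> 'g) \<Rightarrow> bool"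
  where "free_godel_algebra L G e \<longleftrightarrow>
    godel_algebra G \<and> e \<in> lattice_homs L G \<and>
    (\<forall>(H :: ('l + 'g) list gorder) f. godel_algebra H \<longrightarrow> f \<in> lattice_homs L H \<longrightarrow>
      (\<exists>!g. g \<in> extensional (carrier G) \<and> g \<in> heyting_homs G H \<and>
            (\<forall>x \<in> carrier L. g (e x) = f x)))"

lemma heyting_imp_eqI:
  assumes "partial_order L" "greatest L z {w \<in> carrier L. x \<sqinter>\<^bsub>L\<^esub> w \<sqsubseteq>\<^bsub>L\<^esub> y}"
  shows "x \<Rrightarrow>\<^bsub>L\<^esub> y = z"
proof -
  interpret partial_order L by fact
  show ?thesis unfolding heyting_imp_def
    by (rule the_equality) (use assms(2) greatest_unique in \<open>blast+\<close>)
qed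

lemma (in heyting_algebra) imp_greatest:
  assumes "x \<in> carrier L" "y \<in> carrier L"
  shows "greatest L (x \<Rrightarrow> y) {w \<in> carrier L. x \<sqinter> w \<sqsubseteq> y}"
  using imp_exists[OF assms] heyting_imp_eqI[OF partial_order_axioms] by metis

lemma (in heyting_algebra) imp_closed [simp]:
  "\<lbrakk>x \<in> carrier L; y \<in> carrier L\<rbrakk> \<Longrightarrow> x \<Rrightarrow> y \<in> carrier L"
  using imp_greatest by (auto simp: greatest_def)

lemma (in upper_semilattice) join_eqI:
  assumes "least L z (Upper L {x, y})"
  shows "x \<squnion> y = z"
  unfolding join_def Lattice.sup_def
  by (rule some_equality) (use assms least_unique in blast)+

lemma (in lower_semilattice) meet_eqI:
  assumes "greatest L z (Lower L {x, y})"
  shows "x \<sqinter> y = z"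
  unfolding meet_def Lattice.inf_def
  by (rule some_equality) (use assms greatest_unique in blast)+

text \<open>A subset closed under the operations, presented through an order embedding, is a subalgebra.\<close>

lemma godel_embedding:
  fixes M :: "'m gorder" and H :: "'h gorder"
  assumes H: "godel_algebra H"
    and eqM: "eq M = (=)"
    and p: "p \<in> carrier M \<rightarrow> carrier H" and inj: "inj_on p (carrier M)"
    and le: "\<And>x y. \<lbrakk>x \<in> carrier M; y \<in> carrier M\<rbrakk> \<Longrightarrow> x \<sqsubseteq>\<^bsub>M\<^esub> y \<longleftrightarrow> p x \<sqsubseteq>\<^bsub>H\<^esub> p y"
    and bot: "\<bottom>\<^bsub>H\<^esub> \<in> p ` carrier M" and top: "\<top>\<^bsub>H\<^esub> \<in> p ` carrier M"
    and meet: "\<And>x y. \<lbrakk>x \<in> carrier M; y \<in> carrier M\<rbrakk> \<Longrightarrow> p x \<sqinter>\<^bsub>H\<^esub> p y \<in> p ` carrier M"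
    and join: "\<And>x y. \<lbrakk>x \<in> carrier M; y \<in> carrier M\<rbrakk> \<Longrightarrow> p x \<squnion>\<^bsub>H\<^esub> p y \<in> p ` carrier M"
    and imp: "\<And>x y. \<lbrakk>x \<in> carrier M; y \<in> carrier M\<rbrakk> \<Longrightarrow> p x \<Rrightarrow>\<^bsub>H\<^esub> p y \<in> p ` carrier M"
  shows "godel_algebra M" "p \<in> heyting_homs M H"
proof -
  interpret H: godel_algebra H by fact
  have pc: "p x \<in> carrier H" if "x \<in> carrier M" for x using p that by auto
  interpret M: partial_order M
  proof
    show "(.=\<^bsub>M\<^esub>) = (=)" by fact
    show "x .=\<^bsub>M\<^esub> y" if "x \<sqsubseteq>\<^bsub>M\<^esub> y" "y \<sqsubseteq>\<^bsub>M\<^esub> x" "x \<in> carrier M" "y \<in> carrier M" for x y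
      using that eqM le pc inj_onD[OF inj] H.le_antisym[of "p x" "p y"] by simp
  qed (use eqM le pc in \<open>auto intro: H.le_trans\<close>)
  have J: "least M z (Upper M {x, y})"
    if "x \<in> carrier M" "y \<in> carrier M" "z \<in> carrier M" "p z = p x \<squnion>\<^bsub>H\<^esub> p y" for x y z
    using that by (auto simp: least_def Upper_def le pc H.join_left H.join_right intro!: H.join_le)
  have I: "greatest M z (Lower M {x, y})"
    if "x \<in> carrier M" "y \<in> carrier M" "z \<in> carrier M" "p z = p x \<sqinter>\<^bsub>H\<^esub> p y" for x y z
    using that by (auto simp: greatest_def Lower_def le pc H.meet_left H.meet_right intro!: H.meet_le)
  obtain b where b: "b \<in> carrier M" "p b = \<bottom>\<^bsub>H\<^esub>" using bot by auto
  obtain t where t: "t \<in> carrier M" "p t = \<top>\<^bsub>H\<^esub>" using top by auto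
  interpret M: bounded_lattice M
  proof
    show "\<exists>s. least M s (Upper M {x, y})" if "x \<in> carrier M" "y \<in> carrier M" for x y
      using join[OF that] J[OF that] by (metis imageE)
    show "\<exists>s. greatest M s (Lower M {x, y})" if "x \<in> carrier M" "y \<in> carrier M" for x y
      using meet[OF that] I[OF that] by (metis imageE)
    show "\<exists>x. least M x (carrier M)" using b pc le by (auto simp: least_def)
    show "\<exists>x. greatest M x (carrier M)" using t pc le by (auto simp: greatest_def)
  qed
  have pj: "p (x \<squnion>\<^bsub>M\<^esub> y) = p x \<squnion>\<^bsub>H\<^esub> p y" if "x \<in> carrier M" "y \<in> carrier M" for x y
    using join[OF that] M.join_eqI[OF J[OF that]] by (metis imageE)
  have pm: "p (x \<sqinter>\<^bsub>M\<^esub> y) = p x \<sqinter>\<^bsub>H\<^esub> p y" if "x \<in> carrier M" "y \<in> carrier M" for x y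
    using meet[OF that] M.meet_eqI[OF I[OF that]] by (metis imageE)
  have pb: "p \<bottom>\<^bsub>M\<^esub> = \<bottom>\<^bsub>H\<^esub>" 
    using M.bottom_eq[of b] b pc le by simp
  have pt: "p \<top>\<^bsub>M\<^esub> = \<top>\<^bsub>H\<^esub>" 
    using M.top_eq[of t] t pc le by simp
  have G: "greatest M z {w \<in> carrier M. x \<sqinter>\<^bsub>M\<^esub> w \<sqsubseteq>\<^bsub>M\<^esub> y}"
    if "x \<in> carrier M" "y \<in> carrier M" "z \<in> carrier M" "p z = p x \<Rrightarrow>\<^bsub>H\<^esub> p y" for x y z
    using that H.imp_greatest[of "p x" "p y"] by (auto simp: greatest_def le pc pm)
  have pi: "p (x \<Rrightarrow>\<^bsub>M\<^esub> y) = p x \<Rrightarrow>\<^bsub>H\<^esub> p y" if "x \<in> carrier M" "y \<in> carrier M" for x y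
    using imp[OF that] heyting_imp_eqI[OF M.partial_order_axioms G[OF that]] by (metis imageE)
  interpret M: heyting_algebra M
  proof
    show "\<exists>z. greatest M z {w \<in> carrier M. x \<sqinter>\<^bsub>M\<^esub> w \<sqsubseteq>\<^bsub>M\<^esub> y}"
      if "x \<in> carrier M" "y \<in> carrier M" for x y
      using imp[OF that] G[OF that] by (metis imageE)
  qed
  show "godel_algebra M"
  proof
    show "(x \<Rrightarrow>\<^bsub>M\<^esub> y) \<squnion>\<^bsub>M\<^esub> (y \<Rrightarrow>\<^bsub>M\<^esub> x) = \<top>\<^bsub>M\<^esub>"
      if "x \<in> carrier M" "y \<in> carrier M" for x y
      by (rule inj_onD[OF inj]) (use that in \<open>auto simp: pj pi pt pc H.prelinear\<close>)
  qed
  show "p \<in> heyting_homs M H"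
    using p by (auto simp: heyting_homs_def lattice_homs_def join_pres_def meet_pres_def
        pj pm pb pt pi M.lattice_axioms H.lattice_axioms)
qed

lemma heyting_homs_comp:
  assumes "g \<in> heyting_homs A B" "h \<in> heyting_homs B C" "heyting_algebra A"
  shows "compose (carrier A) h g \<in> heyting_homs A C"
proof -
  interpret heyting_algebra A by fact
  show ?thesis using assms
    by (auto simp: heyting_homs_def lattice_homs_def join_pres_def meet_pres_def compose_def Pi_iff)
qed

lemma lattice_homs_reflect:
  assumes p: "p \<in> lattice_homs M H" and inj: "inj_on p (carrier M)"
    and A: "bounded_lattice A" and M: "bounded_lattice M"
    and k: "k \<in> carrier A \<rightarrow> carrier M" and f: "f \<in> lattice_homs A H"
    and pk: "\<And>x. x \<in> carrier A \<Longrightarrow> p (k x) = f x"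
  shows "k \<in> lattice_homs A M"
proof -
  interpret A: bounded_lattice A by fact
  interpret M: bounded_lattice M by fact
  have kc: "k x \<in> carrier M" if "x \<in> carrier A" for x using k that by auto
  note defs = lattice_homs_def join_pres_def meet_pres_def
  have "k (x \<squnion>\<^bsub>A\<^esub> y) = k x \<squnion>\<^bsub>M\<^esub> k y" "k (x \<sqinter>\<^bsub>A\<^esub> y) = k x \<sqinter>\<^bsub>M\<^esub> k y"
    if "x \<in> carrier A" "y \<in> carrier A" for x y
    using that p f by (auto intro!: inj_onD[OF inj] simp: kc pk defs)
  moreover have "k \<bottom>\<^bsub>A\<^esub> = \<bottom>\<^bsub>M\<^esub>" "k \<top>\<^bsub>A\<^esub> = \<top>\<^bsub>M\<^esub>"
    using p f by (auto intro!: inj_onD[OF inj] simp: kc pk defs)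
  ultimately show ?thesis
    using k by (auto simp: defs A.lattice_axioms M.lattice_axioms)
qed

lemma heyting_homs_reflect:
  assumes p: "p \<in> heyting_homs M H" and inj: "inj_on p (carrier M)"
    and A: "heyting_algebra A" and M: "heyting_algebra M"
    and k: "k \<in> carrier A \<rightarrow> carrier M" and f: "f \<in> heyting_homs A H"
    and pk: "\<And>x. x \<in> carrier A \<Longrightarrow> p (k x) = f x"
  shows "k \<in> heyting_homs A M"
proof -
  interpret A: heyting_algebra A by fact
  interpret M: heyting_algebra M by fact
  have kc: "k x \<in> carrier M" if "x \<in> carrier A" for x using k that by auto
  have "k \<in> lattice_homs A M"
    using lattice_homs_reflect[OF _ inj A.bounded_lattice_axioms M.bounded_lattice_axioms k _ pk]
      p f by (auto simp: heyting_homs_def)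
  moreover have "k (x \<Rrightarrow>\<^bsub>A\<^esub> y) = k x \<Rrightarrow>\<^bsub>M\<^esub> k y" if "x \<in> carrier A" "y \<in> carrier A" for x y
    using that p f by (auto intro!: inj_onD[OF inj] simp: kc pk heyting_homs_def)
  ultimately show ?thesis by (auto simp: heyting_homs_def)
qed

primrec godel_stage :: "'h gorder \<Rightarrow> 'h set \<Rightarrow> nat \<Rightarrow> 'h set" where
  "godel_stage H S 0 = insert \<bottom>\<^bsub>H\<^esub> (insert \<top>\<^bsub>H\<^esub> S)"
| "godel_stage H S (Suc n) = godel_stage H S n \<union>
     ((\<lambda>(x, y). x \<sqinter>\<^bsub>H\<^esub> y) ` (godel_stage H S n \<times> godel_stage H S n) \<union>
     ((\<lambda>(x, y). x \<squnion>\<^bsub>H\<^esub> y) ` (godel_stage H S n \<times> godel_stage H S n) \<union>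
      (\<lambda>(x, y). x \<Rrightarrow>\<^bsub>H\<^esub> y) ` (godel_stage H S n \<times> godel_stage H S n)))"

context
  includes cardinal_syntax
begin

lemma card_Un_le:
  assumes "infinite (UNIV :: 'u set)" "|A| \<le>o |UNIV :: 'u set|" "|B| \<le>o |UNIV :: 'u set|"
  shows "|A \<union> B| \<le>o |UNIV :: 'u set|"
  by (rule card_of_Un_ordLeq_infinite_Field)
     (use assms card_of_Card_order[of "UNIV :: 'u set"] in \<open>simp_all add: Field_card_of\<close>)

lemma godel_stage_card:
  assumes "infinite (UNIV :: 'u set)" "|S| \<le>o |UNIV :: 'u set|"
  shows "|godel_stage H S n| \<le>o |UNIV :: 'u set|"
proof (induction n)
  case 0
  have sing: "|{x :: 'a}| \<le>o |UNIV :: 'u set|" for x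
    by (rule card_of_singl_ordLeq) simp
  have "|{\<bottom>\<^bsub>H\<^esub>} \<union> ({\<top>\<^bsub>H\<^esub>} \<union> S)| \<le>o |UNIV :: 'u set|"
    by (intro card_Un_le assms sing)
  then show ?case by (simp add: insert_commute)
next
  case (Suc n)
  have "|f ` (godel_stage H S n \<times> godel_stage H S n)| \<le>o |UNIV :: 'u set|" for f :: "_ \<Rightarrow> 'a"
    by (rule ordLeq_transitive[OF card_of_image])
       (rule card_of_Times_ordLeq_infinite_Field,
        use assms(1) Suc card_of_Card_order[of "UNIV :: 'u set"] in \<open>simp_all add: Field_card_of\<close>)
  then show ?case
    unfolding godel_stage.simps by (intro card_Un_le assms Suc)
qed

lemma small_godel_subalgebra:
  fixes H :: "'h gorder"
  assumes H: "godel_algebra H" and S: "S \<subseteq> carrier H"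
    and inf: "infinite (UNIV :: 'u set)" and card: "|S| \<le>o |UNIV :: 'u set|"
  shows "\<exists>(M :: 'u gorder) p. godel_algebra M \<and> p \<in> heyting_homs M H \<and>
           inj_on p (carrier M) \<and> S \<subseteq> p ` carrier M"
proof -
  interpret H: godel_algebra H by fact
  define T where "T = godel_stage H S"
  define K where "K = (\<Union>n. T n)"
  have mono: "T m \<subseteq> T n" if "m \<le> n" for m n
    using that by (rule lift_Suc_mono_le[rotated]) (auto simp: T_def)
  have Tc: "T n \<subseteq> carrier H" for n
    unfolding T_def
  proof (induction n)
    case (Suc n)
    have "x \<in> carrier H" if "x \<in> godel_stage H S n" for x using Suc that by blast
    then show ?case by auto
  qed (use S in auto)
  have K: "K \<subseteq> carrier H" "S \<subseteq> K" "\<bottom>\<^bsub>H\<^esub> \<in> K" "\<top>\<^bsub>H\<^esub> \<in> K"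
    using Tc UN_upper[of 0 UNIV T] by (auto simp: K_def T_def)
  have cl: "x \<sqinter>\<^bsub>H\<^esub> y \<in> K \<and> x \<squnion>\<^bsub>H\<^esub> y \<in> K \<and> (x \<Rrightarrow>\<^bsub>H\<^esub> y) \<in> K" if "x \<in> K" "y \<in> K" for x y
  proof -
    from that obtain m n where "x \<in> T m" "y \<in> T n" unfolding K_def by blast
    then have "x \<in> T (max m n)" "y \<in> T (max m n)"
      using mono[of m "max m n"] mono[of n "max m n"] by auto
    then have "x \<sqinter>\<^bsub>H\<^esub> y \<in> T (Suc (max m n)) \<and> x \<squnion>\<^bsub>H\<^esub> y \<in> T (Suc (max m n)) \<and>
               (x \<Rrightarrow>\<^bsub>H\<^esub> y) \<in> T (Suc (max m n))"
      by (force simp: T_def)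
    then show ?thesis by (auto simp: K_def)
  qed
  have "|K| \<le>o |UNIV :: 'u set|"
    unfolding K_def T_def
    by (rule card_of_UNION_ordLeq_infinite[OF inf])
       (use godel_stage_card[OF inf card] inf in \<open>auto simp: infinite_iff_card_of_nat\<close>)
  then obtain q :: "'h \<Rightarrow> 'u" where q: "inj_on q K"
    by (meson card_of_ordLeq)
  define p where "p = inv_into K q"
  define M :: "'u gorder" where "M = \<lparr>carrier = q ` K, eq = (=), le = (\<lambda>x y. p x \<sqsubseteq>\<^bsub>H\<^esub> p y)\<rparr>"
  have Mc: "carrier M = q ` K" by (simp add: M_def)
  have pq: "p (q x) = x" if "x \<in> K" for x using that q by (simp add: p_def)
  have im: "p ` carrier M = K" using pq by (force simp: Mc image_iff)
  have inj: "inj_on p (carrier M)" using pq by (auto simp: Mc inj_on_def)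
  have pK: "p x \<in> K" if "x \<in> carrier M" for x using im that by blast
  have "godel_algebra M" "p \<in> heyting_homs M H"
    by (rule godel_embedding[OF H _ _ inj]; use K pK cl im in \<open>auto simp: M_def\<close>)+
  then show ?thesis using inj im K by blast
qed

theorem free_godel_universal:
  fixes L :: "'l gorder" and G :: "'g gorder" and H :: "'h gorder"
  assumes L: "bounded_distributive_lattice L" and free: "free_godel_algebra L G e"
    and H: "godel_algebra H" and f: "f \<in> lattice_homs L H"
  shows "\<exists>!g. g \<in> extensional (carrier G) \<and> g \<in> heyting_homs G H \<and>
           (\<forall>x \<in> carrier L. g (e x) = f x)"
proof -
  interpret L: bounded_distributive_lattice L by fact
  interpret H: godel_algebra H by fact
  interpret G: godel_algebra G using free by (simp add: free_godel_algebra_def)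
  have e: "e \<in> carrier L \<rightarrow> carrier G"
    using free by (auto simp: free_godel_algebra_def lattice_homs_def)
  let ?U = "UNIV :: ('l + 'g) list set"
  have inf: "infinite ?U" by (rule infinite_UNIV_listI)
  have cl: "|A :: 'l set| \<le>o |?U|" for A
    by (rule card_of_ordLeqI[of "\<lambda>x. [Inl x]"]) (auto simp: inj_on_def)
  have cg: "|A :: 'g set| \<le>o |?U|" for A
    by (rule card_of_ordLeqI[of "\<lambda>x. [Inr x]"]) (auto simp: inj_on_def)
  have lat: "h \<in> lattice_homs A B" "h \<in> carrier A \<rightarrow> carrier B"
    if "h \<in> heyting_homs A B" for h and A :: "'x gorder" and B :: "'y gorder"
    using that by (auto simp: heyting_homs_def lattice_homs_def)
  show ?thesis
  proof (rule ex_ex1I)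
    have fc: "f ` carrier L \<subseteq> carrier H" using f by (auto simp: lattice_homs_def)
    obtain M :: "('l + 'g) list gorder" and p where M: "godel_algebra M" "p \<in> heyting_homs M H"
      "inj_on p (carrier M)" "f ` carrier L \<subseteq> p ` carrier M"
      using small_godel_subalgebra[OF H fc inf ordLeq_transitive[OF card_of_image cl]] by blast
    interpret M: godel_algebra M by fact
    define k where "k = (\<lambda>x. inv_into (carrier M) p (f x))"
    have pk: "p (k x) = f x" and kc: "k x \<in> carrier M" if "x \<in> carrier L" for x
      using that M(4) by (auto simp: k_def f_inv_into_f inv_into_into image_subset_iff)
    have "k \<in> lattice_homs L M"
      by (rule lattice_homs_reflect[OF _ M(3) L.bounded_lattice_axioms M.bounded_lattice_axioms _ f])
         (use M(2) pk kc in \<open>auto simp: heyting_homs_def\<close>)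
    then obtain g where g: "g \<in> heyting_homs G M" "\<forall>x\<in>carrier L. g (e x) = k x"
      using free M(1) unfolding free_godel_algebra_def by blast
    have "compose (carrier G) p g \<in> heyting_homs G H"
      by (rule heyting_homs_comp[OF g(1) M(2) G.heyting_algebra_axioms])
    moreover have "compose (carrier G) p g (e x) = f x" if "x \<in> carrier L" for x
      using that e g(2) pk by (auto simp: compose_def Pi_iff)
    ultimately show "\<exists>g. g \<in> extensional (carrier G) \<and> g \<in> heyting_homs G H \<and>
        (\<forall>x \<in> carrier L. g (e x) = f x)"
      by (intro exI[of _ "compose (carrier G) p g"]) auto
  next
    fix u v
    assume u: "u \<in> extensional (carrier G) \<and> u \<in> heyting_homs G H \<and>
        (\<forall>x \<in> carrier L. u (e x) = f x)"
      and v: "v \<in> extensional (carrier G) \<and> v \<in> heyting_homs G H \<and>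
        (\<forall>x \<in> carrier L. v (e x) = f x)"
    let ?S = "u ` carrier G \<union> v ` carrier G"
    have S: "?S \<subseteq> carrier H" using u v lat(2) by blast
    have cS: "|?S| \<le>o |?U|"
      by (intro card_Un_le inf ordLeq_transitive[OF card_of_image cg])
    obtain M :: "('l + 'g) list gorder" and p where M: "godel_algebra M" "p \<in> heyting_homs M H"
      "inj_on p (carrier M)" "?S \<subseteq> p ` carrier M"
      using small_godel_subalgebra[OF H S inf cS] by blast
    interpret M: godel_algebra M by fact
    define k where "k = (\<lambda>h. restrict (\<lambda>x. inv_into (carrier M) p (h x)) (carrier G))"
    have pk: "p (k h x) = h x" and kc: "k h x \<in> carrier M"
      if "x \<in> carrier G" "h ` carrier G \<subseteq> p ` carrier M" for x h
      using that by (auto simp: k_def f_inv_into_f inv_into_into image_subset_iff)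
    have hom: "k h \<in> heyting_homs G M"
      if "h ` carrier G \<subseteq> p ` carrier M" "h \<in> heyting_homs G H" for h
      by (rule heyting_homs_reflect[OF M(2,3) G.heyting_algebra_axioms M.heyting_algebra_axioms _ that(2)])
         (use pk kc that in auto)
    have ku: "k u \<in> heyting_homs G M" and kv: "k v \<in> heyting_homs G M"
      using hom M(4) u v by auto
    have ext: "k h \<in> extensional (carrier G)" for h by (simp add: k_def)
    have kuv: "k u (e x) = k v (e x)" if "x \<in> carrier L" for x
      using that e u v by (auto simp: k_def Pi_iff)
    have "(\<lambda>x. k v (e x)) \<in> lattice_homs L M"
    proof (rule lattice_homs_reflect[OF lat(1)[OF M(2)] M(3) L.bounded_lattice_axioms
          M.bounded_lattice_axioms _ f])
      show "(\<lambda>x. k v (e x)) \<in> carrier L \<rightarrow> carrier M"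
        using e lat(2)[OF kv] by auto
      show "p (k v (e x)) = f x" if "x \<in> carrier L" for x
        using that e v M(4) pk[of "e x" v] by auto
    qed
    then have "\<exists>!g. g \<in> extensional (carrier G) \<and> g \<in> heyting_homs G M \<and>
        (\<forall>x \<in> carrier L. g (e x) = k v (e x))"
      using free M(1) unfolding free_godel_algebra_def by blast
    then have "k u = k v" using ext ku kv kuv by blast
    then have "u x = v x" if "x \<in> carrier G" for x
      using that pk[of x u] pk[of x v] M(4) by auto
    then show "u = v" using u v by (auto intro: extensionalityI)
  qed
qed

end

end

theory Submission
  imports Defs
begin

text \<open>
  Let \<open>X\<close> be the set of prime filters of \<open>L\<close>.  The free Goedel algebra over \<open>L\<close> is the algebra of
  those up-sets of the forest of nonempty chains \<open>C \<subseteq> X\<close>, ordered by passing to a segment of larger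
  elements, for which membership of \<open>C\<close> only depends on the set \<open>{x \<inter> F | x \<in> C}\<close> of traces on some
  finite \<open>F \<subseteq> L\<close>; the generator \<open>a \<in> L\<close> is sent to the set of chains whose elements all contain
  \<open>a\<close>.  Every such up-set is obtained from generators by finitely many Heyting operations.
  Conversely, the map from \<open>G\<close> to this algebra is injective because a prime filter \<open>p\<close> of \<open>G\<close> is
  represented by the chain of the restrictions to \<open>L\<close> of the prime filters above \<open>p\<close>.

  In the model, the co-implication of \<open>W\<close> and \<open>V\<close> can only be the set of segments of the chains in
  \<open>W - V\<close>.  If \<open>L\<close> is a co-Heyting algebra, then the primes lying above a chain with a given finite
  set of traces form a basic open set, so this set of segments again depends on finitely many
  elements of \<open>L\<close>.  Conversely, the one-element chains in the co-implication of two generators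
  \<open>b\<close>, \<open>a\<close> are the primes containing the filter \<open>{c. b \<le> a \<squnion> c}\<close>, and a filter that is determined by
  finitely many elements in this way is principal.
\<close>

section \<open>Prime filters of bounded distributive lattices\<close>

text \<open>The two equivalences make membership in \<open>p\<close> a homomorphism of bounded
  lattices to the two-element lattice. The one for joins yields upward closure, since
  \<open>x \<sqsubseteq> y\<close> means \<open>x \<squnion> y = y\<close>.\<close>

definition prime_filters :: "('a, 'c) gorder_scheme \<Rightarrow> 'a set set"
  where "prime_filters L = {p. p \<subseteq> carrier L \<and> \<top>\<^bsub>L\<^esub> \<in> p \<and> \<bottom>\<^bsub>L\<^esub> \<notin> p \<and>
    (\<forall>x \<in> carrier L. \<forall>y \<in> carrier L.
      (x \<sqinter>\<^bsub>L\<^esub> y \<in> p \<longleftrightarrow> x \<in> p \<and> y \<in> p) \<and> (x \<squnion>\<^bsub>L\<^esub> y \<in> p \<longleftrightarrow> x \<in> p \<or> y \<in> p))}"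

lemma prime_filtersI:
  assumes "p \<subseteq> carrier L" "\<top>\<^bsub>L\<^esub> \<in> p" "\<bottom>\<^bsub>L\<^esub> \<notin> p"
    and "\<And>x y. \<lbrakk>x \<in> p; y \<in> p\<rbrakk> \<Longrightarrow> x \<sqinter>\<^bsub>L\<^esub> y \<in> p"
    and "\<And>x y. \<lbrakk>x \<in> carrier L; y \<in> carrier L; x \<sqinter>\<^bsub>L\<^esub> y \<in> p\<rbrakk> \<Longrightarrow> x \<in> p \<and> y \<in> p"
    and "\<And>x y. \<lbrakk>x \<in> carrier L; y \<in> carrier L; x \<squnion>\<^bsub>L\<^esub> y \<in> p\<rbrakk> \<Longrightarrow> x \<in> p \<or> y \<in> p"
    and "\<And>x y. \<lbrakk>x \<in> carrier L; y \<in> carrier L; x \<in> p \<or> y \<in> p\<rbrakk> \<Longrightarrow> x \<squnion>\<^bsub>L\<^esub> y \<in> p"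
  shows "p \<in> prime_filters L"
  unfolding prime_filters_def
  by (rule CollectI, intro conjI ballI iffI) (use assms in \<open>blast+\<close>)

lemma prime_filters_sub: "p \<in> prime_filters L \<Longrightarrow> p \<subseteq> carrier L"
  by (simp add: prime_filters_def)

lemma prime_filters_top: "p \<in> prime_filters L \<Longrightarrow> \<top>\<^bsub>L\<^esub> \<in> p"
  by (simp add: prime_filters_def)

lemma prime_filters_bottom: "p \<in> prime_filters L \<Longrightarrow> \<bottom>\<^bsub>L\<^esub> \<notin> p"
  by (simp add: prime_filters_def)

lemma prime_filters_meet:
  "\<lbrakk>p \<in> prime_filters L; x \<in> carrier L; y \<in> carrier L\<rbrakk> \<Longrightarrow> x \<sqinter>\<^bsub>L\<^esub> y \<in> p \<longleftrightarrow> x \<in> p \<and> y \<in> p"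
  by (simp add: prime_filters_def)

lemma prime_filters_join:
  "\<lbrakk>p \<in> prime_filters L; x \<in> carrier L; y \<in> carrier L\<rbrakk> \<Longrightarrow> x \<squnion>\<^bsub>L\<^esub> y \<in> p \<longleftrightarrow> x \<in> p \<or> y \<in> p"
  by (simp add: prime_filters_def)

lemmas prime_filters_simps [simp] =
  prime_filters_top prime_filters_bottom prime_filters_meet prime_filters_join

lemma (in lattice) meet_mono:
  assumes "a \<sqsubseteq> c" "b \<sqsubseteq> d" "a \<in> carrier L" "b \<in> carrier L" "c \<in> carrier L" "d \<in> carrier L"
  shows "a \<sqinter> b \<sqsubseteq> c \<sqinter> d"
  using assms by (intro meet_le le_trans[OF meet_left, of _ _ c] le_trans[OF meet_right, of _ _ d]) auto

lemma (in lattice) join_mono: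
  assumes "a \<sqsubseteq> c" "b \<sqsubseteq> d" "a \<in> carrier L" "b \<in> carrier L" "c \<in> carrier L" "d \<in> carrier L"
  shows "a \<squnion> b \<sqsubseteq> c \<squnion> d"
  using assms by (intro join_le le_trans[OF _ join_left, of a c] le_trans[OF _ join_right, of b d]) auto

context bounded_distributive_lattice
begin

lemma prime_filters_up:
  assumes "p \<in> prime_filters L" "x \<in> p" "x \<sqsubseteq> y" "y \<in> carrier L"
  shows "y \<in> p"
  using assms le_iff_meet[of x y] prime_filters_join[of p L x y] prime_filters_sub[of p L] by auto

text \<open>Zorn's lemma gives a maximal meet-closed set that contains \<open>A\<close> and has no
  element below an element of \<open>B\<close>; maximality makes it upward closed and, by
  distributivity, prime. As \<open>A\<close> and \<open>B\<close> need not be a filter and an ideal,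
  separation is stated with the order instead of disjointness.\<close>

theorem prime_separation:
  assumes A: "A \<subseteq> carrier L" "A \<noteq> {}" "\<And>x y. \<lbrakk>x \<in> A; y \<in> A\<rbrakk> \<Longrightarrow> x \<sqinter> y \<in> A"
    and B: "B \<subseteq> carrier L" "B \<noteq> {}" "\<And>x y. \<lbrakk>x \<in> B; y \<in> B\<rbrakk> \<Longrightarrow> x \<squnion> y \<in> B"
    and disj: "\<And>a b. \<lbrakk>a \<in> A; b \<in> B\<rbrakk> \<Longrightarrow> \<not> a \<sqsubseteq> b"
  shows "\<exists>p \<in> prime_filters L. A \<subseteq> p \<and> p \<inter> B = {}"
proof -
  define \<F> where "\<F> = {F. A \<subseteq> F \<and> F \<subseteq> carrier L \<and> (\<forall>x\<in>F. \<forall>y\<in>F. x \<sqinter> y \<in> F) \<and>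
    (\<forall>a\<in>F. \<forall>b\<in>B. \<not> a \<sqsubseteq> b)}"
  have \<F>I: "F \<in> \<F>" if "A \<subseteq> F" "F \<subseteq> carrier L" "\<And>x y. \<lbrakk>x \<in> F; y \<in> F\<rbrakk> \<Longrightarrow> x \<sqinter> y \<in> F"
    "\<And>a b. \<lbrakk>a \<in> F; b \<in> B\<rbrakk> \<Longrightarrow> \<not> a \<sqsubseteq> b" for F
    using that by (simp add: \<F>_def)
  have "\<exists>M\<in>\<F>. \<forall>X\<in>\<F>. M \<subseteq> X \<longrightarrow> X = M"
  proof (rule subset_Zorn_nonempty)
    show "\<F> \<noteq> {}" using A disj by (auto simp: \<F>_def)
    fix \<C> assume ne: "\<C> \<noteq> {}" and ch: "subset.chain \<F> \<C>"
    have CF: "X \<in> \<F>" if "X \<in> \<C>" for X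
      using ch that by (auto simp: subset.chain_def)
    have "x \<sqinter> y \<in> \<Union>\<C>" if xy: "x \<in> \<Union>\<C>" "y \<in> \<Union>\<C>" for x y
    proof -
      obtain X Y where "x \<in> X" "X \<in> \<C>" "y \<in> Y" "Y \<in> \<C>" using xy by auto
      moreover have "X \<subseteq> Y \<or> Y \<subseteq> X"
        using ch calculation by (auto simp: subset.chain_def)
      ultimately obtain Z where "Z \<in> \<C>" "x \<in> Z" "y \<in> Z" by blast
      with CF[of Z] have "x \<sqinter> y \<in> Z" by (simp add: \<F>_def)
      with \<open>Z \<in> \<C>\<close> show ?thesis by (rule UnionI)
    qed
    moreover have "A \<subseteq> X" "X \<subseteq> carrier L" "\<forall>a\<in>X. \<forall>b\<in>B. \<not> a \<sqsubseteq> b" if "X \<in> \<C>" for X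
      using CF[OF that] by (auto simp: \<F>_def)
    then have "A \<subseteq> \<Union>\<C>" "\<Union>\<C> \<subseteq> carrier L" "\<forall>a\<in>\<Union>\<C>. \<forall>b\<in>B. \<not> a \<sqsubseteq> b"
      using ne by blast+
    ultimately show "\<Union>\<C> \<in> \<F>" by (simp add: \<F>_def)
  qed
  then obtain M where M: "M \<in> \<F>" and max: "\<And>X. \<lbrakk>X \<in> \<F>; M \<subseteq> X\<rbrakk> \<Longrightarrow> X = M" by blast
  have Mc: "M \<subseteq> carrier L" and MA: "A \<subseteq> M" and Mm: "\<And>x y. \<lbrakk>x \<in> M; y \<in> M\<rbrakk> \<Longrightarrow> x \<sqinter> y \<in> M"
    and Md: "\<And>a b. \<lbrakk>a \<in> M; b \<in> B\<rbrakk> \<Longrightarrow> \<not> a \<sqsubseteq> b"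
    using M by (auto simp: \<F>_def)
  \<comment> \<open>Maximality in usable form: the upward closure \<open>?X\<close> of all
    \<open>f \<sqinter> x\<close> with \<open>f \<in> M\<close> is meet-closed and contains
    \<open>M\<close> and \<open>x\<close>. If \<open>x \<notin> M\<close>, it cannot be separated
    from \<open>B\<close>.\<close>
  have grow: "\<exists>f\<in>M. \<exists>b\<in>B. f \<sqinter> x \<sqsubseteq> b" if x: "x \<in> carrier L" "x \<notin> M" for x
  proof (rule ccontr)
    assume neg: "\<not> ?thesis"
    let ?X = "{g \<in> carrier L. \<exists>f\<in>M. f \<sqinter> x \<sqsubseteq> g}"
    have MX: "M \<subseteq> ?X"
      using Mc x meet_left by blast
    obtain a where "a \<in> M" using A MA by blast
    then have xX: "x \<in> ?X" using x Mc meet_right by blast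
    have cl: "g \<sqinter> h \<in> ?X" if gh: "g \<in> ?X" "h \<in> ?X" for g h
    proof -
      obtain f k where fk: "f \<in> M" "k \<in> M" "f \<sqinter> x \<sqsubseteq> g" "k \<sqinter> x \<sqsubseteq> h" using gh by blast
      then have c: "f \<in> carrier L" "k \<in> carrier L" using Mc by auto
      have "(f \<sqinter> k) \<sqinter> x \<sqsubseteq> f \<sqinter> x" "(f \<sqinter> k) \<sqinter> x \<sqsubseteq> k \<sqinter> x"
        using c x by (auto intro!: meet_mono meet_left meet_right)
      then have "(f \<sqinter> k) \<sqinter> x \<sqsubseteq> g" "(f \<sqinter> k) \<sqinter> x \<sqsubseteq> h"
        using fk c x gh le_trans[of "(f \<sqinter> k) \<sqinter> x" "f \<sqinter> x" g]
          le_trans[of "(f \<sqinter> k) \<sqinter> x" "k \<sqinter> x" h] by simp_all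
      then have "(f \<sqinter> k) \<sqinter> x \<sqsubseteq> g \<sqinter> h"
        using c x gh by (simp add: meet_le)
      then show ?thesis using fk Mm gh by auto
    qed
    have dis: "\<not> g \<sqsubseteq> b" if gb: "g \<in> ?X" "b \<in> B" for g b
    proof
      assume "g \<sqsubseteq> b"
      moreover obtain f where f: "f \<in> M" "f \<sqinter> x \<sqsubseteq> g" using gb by blast
      moreover have "f \<in> carrier L" "b \<in> carrier L" "g \<in> carrier L" using f gb Mc B(1) by auto
      ultimately have "f \<sqinter> x \<sqsubseteq> b"
        using le_trans[of "f \<sqinter> x" g b] x by simp
      with neg gb f show False by blast
    qed
    have "A \<subseteq> ?X" "?X \<subseteq> carrier L" using MX MA by blast+
    from \<F>I[OF this cl dis] have "?X \<in> \<F>" .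
    then show False using max[OF _ MX] xX x by blast
  qed
  have up: "y \<in> M" if xy: "x \<in> M" "x \<sqsubseteq> y" "y \<in> carrier L" for x y
  proof (rule ccontr)
    assume "y \<notin> M"
    then obtain f b where fb: "f \<in> M" "b \<in> B" "f \<sqinter> y \<sqsubseteq> b" using grow xy by blast
    then have c: "f \<in> carrier L" "b \<in> carrier L" "x \<in> carrier L" using xy Mc B(1) by auto
    then have "f \<sqinter> x \<sqsubseteq> f \<sqinter> y"
      using xy by (simp add: meet_mono)
    then have "f \<sqinter> x \<sqsubseteq> b"
      using le_trans[of "f \<sqinter> x" "f \<sqinter> y" b] fb xy c by simp
    then show False using Md[OF Mm] fb xy by blast
  qed
  have join: "x \<in> M \<or> y \<in> M" if xy: "x \<in> carrier L" "y \<in> carrier L" "x \<squnion> y \<in> M" for x y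
  proof (rule ccontr)
    assume "\<not> ?thesis"
    then obtain f b k c where fb: "f \<in> M" "b \<in> B" "f \<sqinter> x \<sqsubseteq> b" "k \<in> M" "c \<in> B" "k \<sqinter> y \<sqsubseteq> c"
      using grow xy by metis
    have car: "f \<in> carrier L" "k \<in> carrier L" "b \<in> carrier L" "c \<in> carrier L"
      using fb Mc B(1) by auto
    have "(f \<sqinter> k) \<sqinter> x \<sqsubseteq> f \<sqinter> x" "(f \<sqinter> k) \<sqinter> y \<sqsubseteq> k \<sqinter> y"
      using car xy by (auto intro!: meet_mono meet_left meet_right)
    then have "(f \<sqinter> k) \<sqinter> x \<sqsubseteq> b" "(f \<sqinter> k) \<sqinter> y \<sqsubseteq> c"
      using fb car xy le_trans[of "(f \<sqinter> k) \<sqinter> x" "f \<sqinter> x" b]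
        le_trans[of "(f \<sqinter> k) \<sqinter> y" "k \<sqinter> y" c] by simp_all
    \<comment> \<open>Distributivity merges the two bounds into one for
      \<open>(f \<sqinter> k) \<sqinter> (x \<squnion> y)\<close>, which is an element of
      \<open>M\<close>.\<close>
    then have "(f \<sqinter> k) \<sqinter> (x \<squnion> y) \<sqsubseteq> b \<squnion> c"
      using car xy by (simp add: meet_join_distrib join_mono)
    then show False using Md[OF Mm[OF Mm]] fb xy B(3) by blast
  qed
  have "M \<in> prime_filters L"
  proof (rule prime_filtersI[OF Mc _ _ Mm _ join])
    show "\<top> \<in> M" using up A MA Mc by blast
    show "\<bottom> \<notin> M" using Md B(1,2) bottom_lower by blast
    show "x \<in> M \<and> y \<in> M" if "x \<in> carrier L" "y \<in> carrier L" "x \<sqinter> y \<in> M" for x y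
      using up that meet_left meet_right by blast
    show "x \<squnion> y \<in> M" if "x \<in> carrier L" "y \<in> carrier L" "x \<in> M \<or> y \<in> M" for x y
      using up that join_left join_right join_closed by blast
  qed
  moreover have "M \<inter> B = {}" using Md B(1) by fastforce
  ultimately show ?thesis using MA by blast
qed

text \<open>Prime separation for the singletons \<open>{x}\<close> and \<open>{y}\<close>. It
  reduces inequalities in \<open>L\<close> to propositional reasoning about membership in
  primes.\<close>

lemma le_iff_prime:
  assumes "x \<in> carrier L" "y \<in> carrier L"
  shows "x \<sqsubseteq> y \<longleftrightarrow> (\<forall>p \<in> prime_filters L. x \<in> p \<longrightarrow> y \<in> p)"
proof
  show "\<forall>p \<in> prime_filters L. x \<in> p \<longrightarrow> y \<in> p" if "x \<sqsubseteq> y"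
    using that prime_filters_up assms by blast
  assume r: "\<forall>p \<in> prime_filters L. x \<in> p \<longrightarrow> y \<in> p"
  have "x \<sqinter> x = x" "y \<squnion> y = y"
    using assms le_iff_join[of x x] le_iff_meet[of y y] by simp_all
  then show "x \<sqsubseteq> y"
    using prime_separation[of "{x}" "{y}"] assms r by auto
qed

text \<open>Specifying the meet by the primes that contain it determines it, by
  \<open>le_iff_prime\<close>, and avoids an iterated operation. The empty meet is
  \<open>\<top>\<close>; in the dual lemma the empty join is \<open>\<bottom>\<close>, which lies in
  no prime.\<close>

lemma finite_meet_exists:
  assumes "finite F" "F \<subseteq> carrier L"
  shows "\<exists>m \<in> carrier L. \<forall>p \<in> prime_filters L. m \<in> p \<longleftrightarrow> F \<subseteq> p"
  using assms
proof induction
  case empty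
  show ?case by (rule bexI[of _ \<top>]) auto
next
  case (insert a F)
  then obtain m where "m \<in> carrier L" "\<forall>p \<in> prime_filters L. m \<in> p \<longleftrightarrow> F \<subseteq> p" by auto
  then show ?case using insert.prems by (intro bexI[of _ "a \<sqinter> m"]) auto
qed

lemma finite_join_exists:
  assumes "finite F" "F \<subseteq> carrier L"
  shows "\<exists>j \<in> carrier L. \<forall>p \<in> prime_filters L. j \<in> p \<longleftrightarrow> F \<inter> p \<noteq> {}"
  using assms
proof induction
  case empty
  show ?case by (rule bexI[of _ \<bottom>]) auto
next
  case (insert a F)
  then obtain m where "m \<in> carrier L" "\<forall>p \<in> prime_filters L. m \<in> p \<longleftrightarrow> F \<inter> p \<noteq> {}" by auto
  then show ?case using insert.prems by (intro bexI[of _ "a \<squnion> m"]) auto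
qed

lemma prime_between:
  assumes A: "A \<subseteq> carrier L" "A \<noteq> {}" "\<And>x y. \<lbrakk>x \<in> A; y \<in> A\<rbrakk> \<Longrightarrow> x \<sqinter> y \<in> A"
    and "b \<in> carrier L" and "\<And>a. a \<in> A \<Longrightarrow> \<not> a \<sqsubseteq> b"
  shows "\<exists>p \<in> prime_filters L. A \<subseteq> p \<and> b \<notin> p"
proof -
  have "b \<squnion> b = b" using assms le_iff_meet[of b b] by simp
  then show ?thesis using prime_separation[OF A, of "{b}"] assms by auto
qed

text \<open>Co-implication read off from primes. The last hypothesis keeps \<open>b\<close> out of
  the ideal \<open>B\<close> generated by \<open>a\<close> and the complement of \<open>q\<close>,
  which is closed under joins since \<open>q\<close> is prime; a prime separating \<open>b\<close>
  from \<open>B\<close> is the required one.\<close>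

lemma prime_below:
  assumes q: "q \<in> prime_filters L" and a: "a \<in> carrier L" and b: "b \<in> carrier L"
    and c: "\<And>c. \<lbrakk>c \<in> carrier L; b \<sqsubseteq> a \<squnion> c\<rbrakk> \<Longrightarrow> c \<in> q"
  shows "\<exists>p \<in> prime_filters L. p \<subseteq> q \<and> b \<in> p \<and> a \<notin> p"
proof -
  define B where "B = {x \<in> carrier L. \<exists>c \<in> carrier L - q. x \<sqsubseteq> a \<squnion> c}"
  have BI: "x \<in> B" if "x \<in> carrier L" "c \<in> carrier L" "c \<notin> q" "x \<sqsubseteq> a \<squnion> c" for x c
    using that unfolding B_def by blast
  have aB: "a \<in> B" by (rule BI[of a \<bottom>]) (use a q in \<open>auto intro: join_left\<close>)
  have "\<exists>p \<in> prime_filters L. {b} \<subseteq> p \<and> p \<inter> B = {}"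
  proof (rule prime_separation)
    show "B \<subseteq> carrier L" "B \<noteq> {}" using aB by (auto simp: B_def)
    show "{b} \<subseteq> carrier L" "{b} \<noteq> {}" using b by auto
    show "x \<sqinter> y \<in> {b}" if "x \<in> {b}" "y \<in> {b}" for x y
      using that b le_iff_join[of b b] by simp
    show "x \<squnion> y \<in> B" if xy: "x \<in> B" "y \<in> B" for x y
    proof -
      obtain c d where cd: "c \<in> carrier L" "d \<in> carrier L" "c \<notin> q" "d \<notin> q"
        "x \<sqsubseteq> a \<squnion> c" "y \<sqsubseteq> a \<squnion> d" and c: "x \<in> carrier L" "y \<in> carrier L"
        using xy unfolding B_def by blast
      then have "a \<squnion> c \<sqsubseteq> a \<squnion> (c \<squnion> d)" "a \<squnion> d \<sqsubseteq> a \<squnion> (c \<squnion> d)"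
        using a by (auto intro!: join_mono join_left join_right)
      then have "x \<sqsubseteq> a \<squnion> (c \<squnion> d)" "y \<sqsubseteq> a \<squnion> (c \<squnion> d)"
        using cd c a le_trans[of x "a \<squnion> c" "a \<squnion> (c \<squnion> d)"]
          le_trans[of y "a \<squnion> d" "a \<squnion> (c \<squnion> d)"] by simp_all
      then have "x \<squnion> y \<sqsubseteq> a \<squnion> (c \<squnion> d)"
        using cd c a by (simp add: join_le)
      then show ?thesis using cd c q by (intro BI[of _ "c \<squnion> d"]) simp_all
    qed
    fix x y assume xy: "x \<in> {b}" "y \<in> B"
    then obtain d where d: "d \<in> carrier L" "d \<notin> q" "y \<sqsubseteq> a \<squnion> d" "y \<in> carrier L"
      unfolding B_def by blast
    show "\<not> x \<sqsubseteq> y"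
      using c[OF d(1)] d xy le_trans[of b y "a \<squnion> d"] a b by auto
  qed
  then obtain p where p: "p \<in> prime_filters L" "b \<in> p" "p \<inter> B = {}" by auto
  have "x \<in> B" if "x \<in> carrier L" "x \<notin> q" for x
    using that a by (intro BI[of _ x]) (simp_all add: join_right)
  then have "p \<subseteq> q" using p prime_filters_sub[of p L] by blast
  then show ?thesis using p aB by blast
qed

text \<open>Primality is where the chain matters: if one member omits \<open>x\<close> and another
  omits \<open>y\<close>, the smaller of the two omits both and hence
  \<open>x \<squnion> y\<close>.\<close>

lemma Inter_chain_prime:
  assumes "C \<subseteq> prime_filters L" "C \<noteq> {}" "\<And>x y. \<lbrakk>x \<in> C; y \<in> C\<rbrakk> \<Longrightarrow> x \<subseteq> y \<or> y \<subseteq> x"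
  shows "\<Inter>C \<in> prime_filters L"
proof -
  have *: "p \<in> prime_filters L" if "p \<in> C" for p using assms(1) that by blast
  show ?thesis
  proof (rule prime_filtersI)
    show "\<Inter>C \<subseteq> carrier L" using assms(2) prime_filters_sub[OF *] by blast
    show "x \<in> \<Inter>C \<or> y \<in> \<Inter>C" if xy: "x \<in> carrier L" "y \<in> carrier L" "x \<squnion> y \<in> \<Inter>C" for x y
    proof (rule ccontr)
      assume "\<not> ?thesis"
      then obtain p q where "p \<in> C" "x \<notin> p" "q \<in> C" "y \<notin> q" by blast
      then obtain r where "r \<in> C" "x \<notin> r" "y \<notin> r" using assms(3)[of p q] by blast
      then show False using xy * prime_filters_join[of r L x y] by blast
    qed
  next
    fix x y assume xy: "x \<in> \<Inter>C" "y \<in> \<Inter>C"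
    have "x \<sqinter> y \<in> p" if "p \<in> C" for p
      using xy that *[OF that] prime_filters_sub[OF *[OF that]] prime_filters_meet[of p L x y] by blast
    then show "x \<sqinter> y \<in> \<Inter>C" by blast
  qed (use * assms(2) in auto)
qed

text \<open>The least \<open>w\<close> with \<open>b \<sqsubseteq> a \<squnion> w\<close> is the
  co-implication: the Heyting implication from \<open>a\<close> to \<open>b\<close> in the order
  dual.\<close>

lemma co_heyting_iff:
  "co_heyting_algebra L \<longleftrightarrow>
    (\<forall>a \<in> carrier L. \<forall>b \<in> carrier L. \<exists>z. least L z {w \<in> carrier L. b \<sqsubseteq> a \<squnion> w})"
proof
  assume "co_heyting_algebra L"
  then interpret D: heyting_algebra "inv_gorder L"
    by (rule co_heyting_algebra.dual_heyting)
  show "\<forall>a \<in> carrier L. \<forall>b \<in> carrier L. \<exists>z. least L z {w \<in> carrier L. b \<sqsubseteq> a \<squnion> w}"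
    using D.imp_exists by simp
next
  assume r: "\<forall>a \<in> carrier L. \<forall>b \<in> carrier L. \<exists>z. least L z {w \<in> carrier L. b \<sqsubseteq> a \<squnion> w}"
  interpret D: lattice "inv_gorder L" by (rule dual_lattice)
  have "heyting_algebra (inv_gorder L)"
    by unfold_locales (use r bottom_exists top_exists in auto)
  then show "co_heyting_algebra L"
    by (intro co_heyting_algebra.intro co_heyting_algebra_axioms.intro distributive_lattice_axioms)
qed

end

section \<open>Residuation and distributivity of Heyting algebras\<close>

lemma (in heyting_algebra) meet_le_iff_le_imp:
  assumes "x \<in> carrier L" "y \<in> carrier L" "z \<in> carrier L"
  shows "x \<sqinter> z \<sqsubseteq> y \<longleftrightarrow> z \<sqsubseteq> x \<Rrightarrow> y"
proof -
  have le: "x \<sqinter> (x \<Rrightarrow> y) \<sqsubseteq> y" and gr: "x \<sqinter> z \<sqsubseteq> y \<Longrightarrow> z \<sqsubseteq> x \<Rrightarrow> y"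
    using imp_greatest[OF assms(1,2)] assms by (auto simp: greatest_def)
  have "x \<sqinter> z \<sqsubseteq> y" if "z \<sqsubseteq> x \<Rrightarrow> y"
  proof -
    have "x \<sqinter> z \<sqsubseteq> x \<sqinter> (x \<Rrightarrow> y)"
      using that assms by (simp add: meet_mono)
    then show ?thesis using le le_trans[of "x \<sqinter> z" "x \<sqinter> (x \<Rrightarrow> y)" y] assms by simp
  qed
  with gr show ?thesis by blast
qed

text \<open>By residuation, meeting with \<open>x\<close> is a left adjoint and so preserves binary
  joins. This gives access to the prime filter results for Heyting algebras.\<close>

lemma (in heyting_algebra) bounded_distributive:
  "bounded_distributive_lattice L"
proof unfold_locales
  fix x y z assume c: "x \<in> carrier L" "y \<in> carrier L" "z \<in> carrier L"
  let ?j = "(x \<sqinter> y) \<squnion> (x \<sqinter> z)"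
  have "y \<sqsubseteq> x \<Rrightarrow> ?j" "z \<sqsubseteq> x \<Rrightarrow> ?j"
    using c by (simp_all add: meet_le_iff_le_imp[symmetric] join_left join_right)
  then have "x \<sqinter> (y \<squnion> z) \<sqsubseteq> ?j"
    using c by (simp add: meet_le_iff_le_imp join_le)
  moreover have "?j \<sqsubseteq> x \<sqinter> (y \<squnion> z)"
    using c by (intro join_le meet_mono) (auto intro: join_left join_right)
  ultimately show "x \<sqinter> (y \<squnion> z) = ?j" using c by (intro le_antisym) auto
qed

lemma (in heyting_algebra) bi_heyting_iff:
  "bi_heyting_algebra L \<longleftrightarrow> co_heyting_algebra L"
proof
  assume "bi_heyting_algebra L"
  then interpret bi_heyting_algebra L .
  show "co_heyting_algebra L" by unfold_locales
next
  assume "co_heyting_algebra L"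
  then interpret co_heyting_algebra L .
  show "bi_heyting_algebra L" by unfold_locales
qed

section \<open>Up-sets of forests\<close>

definition upsets :: "'p set \<Rightarrow> ('p \<Rightarrow> 'p \<Rightarrow> bool) \<Rightarrow> 'p set gorder"
  where "upsets X R = \<lparr>carrier = {S. S \<subseteq> X \<and> (\<forall>x \<in> S. \<forall>y \<in> X. R x y \<longrightarrow> y \<in> S)},
    eq = (=), le = (\<subseteq>)\<rparr>"

text \<open>The implication of Kripke semantics for intuitionistic logic; \<open>R x y\<close> says
  that \<open>y\<close> lies above \<open>x\<close>.\<close>

definition upset_imp :: "'p set \<Rightarrow> ('p \<Rightarrow> 'p \<Rightarrow> bool) \<Rightarrow> 'p set \<Rightarrow> 'p set \<Rightarrow> 'p set"
  where "upset_imp X R S T = {x \<in> X. \<forall>y \<in> X. R x y \<longrightarrow> y \<in> S \<longrightarrow> y \<in> T}"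

lemma upsets_carrier:
  "S \<in> carrier (upsets X R) \<longleftrightarrow> S \<subseteq> X \<and> (\<forall>x \<in> S. \<forall>y \<in> X. R x y \<longrightarrow> y \<in> S)"
  by (simp add: upsets_def)

lemma upsets_le [simp]: "le (upsets X R) = (\<subseteq>)"
  by (simp add: upsets_def)

text \<open>By \<open>branch\<close> the points above a given point are pairwise comparable, so
  branching is downwards; this is the frame condition for prelinearity.\<close>

locale forest =
  fixes X :: "'p set" and R :: "'p \<Rightarrow> 'p \<Rightarrow> bool"
  assumes refl: "x \<in> X \<Longrightarrow> R x x"
    and trans: "\<lbrakk>x \<in> X; y \<in> X; z \<in> X; R x y; R y z\<rbrakk> \<Longrightarrow> R x z"
    and branch: "\<lbrakk>x \<in> X; y \<in> X; z \<in> X; R x y; R x z\<rbrakk> \<Longrightarrow> R y z \<or> R z y"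
begin

abbreviation "U \<equiv> upsets X R"

sublocale U: partial_order U
  by unfold_locales (auto simp: upsets_def)

lemma upsets_join: "S \<in> carrier U \<Longrightarrow> T \<in> carrier U \<Longrightarrow> least U (S \<union> T) (Upper U {S, T})"
  by (auto simp: least_def Upper_def upsets_carrier)

lemma upsets_meet: "S \<in> carrier U \<Longrightarrow> T \<in> carrier U \<Longrightarrow> greatest U (S \<inter> T) (Lower U {S, T})"
  by (auto simp: greatest_def Lower_def upsets_carrier)

lemma upsets_empty: "{} \<in> carrier U" and upsets_full: "X \<in> carrier U"
  by (auto simp: upsets_carrier)

sublocale U: bounded_lattice U
proof
  show "\<exists>s. is_lub U s {x, y}" if "x \<in> carrier U" "y \<in> carrier U" for x y
    using upsets_join[OF that] by blast
  show "\<exists>s. is_glb U s {x, y}" if "x \<in> carrier U" "y \<in> carrier U" for x y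
    using upsets_meet[OF that] by blast
  show "\<exists>x. least U x (carrier U)"
    using upsets_empty by (intro exI[of _ "{}"]) (simp add: least_def)
  show "\<exists>x. greatest U x (carrier U)"
    using upsets_full by (intro exI[of _ X]) (simp add: greatest_def, simp add: upsets_carrier)
qed

lemma join_eq [simp]: "S \<in> carrier U \<Longrightarrow> T \<in> carrier U \<Longrightarrow> S \<squnion>\<^bsub>U\<^esub> T = S \<union> T"
  by (intro U.join_eqI upsets_join)

lemma meet_eq [simp]: "S \<in> carrier U \<Longrightarrow> T \<in> carrier U \<Longrightarrow> S \<sqinter>\<^bsub>U\<^esub> T = S \<inter> T"
  by (intro U.meet_eqI upsets_meet)

lemma bottom_eq [simp]: "\<bottom>\<^bsub>U\<^esub> = {}"
  using U.bottom_eq[of "{}"] upsets_empty by simp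

lemma top_eq [simp]: "\<top>\<^bsub>U\<^esub> = X"
  using U.top_eq[of X] upsets_full by (simp add: upsets_carrier)

lemma upset_imp_closed: "upset_imp X R S T \<in> carrier U"
proof -
  have "y \<in> upset_imp X R S T" if x: "x \<in> upset_imp X R S T" and y: "y \<in> X" "R x y" for x y
    unfolding upset_imp_def
  proof (intro CollectI conjI ballI impI y)
    fix z assume "z \<in> X" "R y z" "z \<in> S"
    moreover have "x \<in> X" using x by (simp add: upset_imp_def)
    ultimately show "z \<in> T" using x y trans[of x y z] by (simp add: upset_imp_def)
  qed
  then show ?thesis unfolding upsets_carrier by (simp add: upset_imp_def Collect_mono_iff subset_iff)
qed

lemma upset_imp_greatest:
  assumes "S \<in> carrier U" "T \<in> carrier U"
  shows "greatest U (upset_imp X R S T) {W \<in> carrier U. S \<sqinter>\<^bsub>U\<^esub> W \<sqsubseteq>\<^bsub>U\<^esub> T}"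
proof -
  have "S \<inter> upset_imp X R S T \<subseteq> T"
    using refl by (simp add: upset_imp_def) blast
  then have "upset_imp X R S T \<in> {W \<in> carrier U. S \<sqinter>\<^bsub>U\<^esub> W \<sqsubseteq>\<^bsub>U\<^esub> T}"
    using assms upset_imp_closed[of S T] by simp
  moreover have "W \<sqsubseteq>\<^bsub>U\<^esub> upset_imp X R S T" if W: "W \<in> carrier U" "S \<sqinter>\<^bsub>U\<^esub> W \<sqsubseteq>\<^bsub>U\<^esub> T" for W
  proof -
    have "S \<inter> W \<subseteq> T" using W assms by simp
    with W(1) show ?thesis by (simp add: upset_imp_def upsets_carrier) blast
  qed
  ultimately show ?thesis unfolding greatest_def by (intro conjI ballI) auto
qed

sublocale U: heyting_algebra U
  by unfold_locales (rule exI, rule upset_imp_greatest)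

lemma imp_eq [simp]: "S \<in> carrier U \<Longrightarrow> T \<in> carrier U \<Longrightarrow> S \<Rrightarrow>\<^bsub>U\<^esub> T = upset_imp X R S T"
  by (intro heyting_imp_eqI U.partial_order_axioms upset_imp_greatest)

sublocale U: godel_algebra U
proof
  fix S T assume ST: "S \<in> carrier U" "T \<in> carrier U"
  \<comment> \<open>A point outside both implications has above it some \<open>y\<close> in
    \<open>S - T\<close> and some \<open>z\<close> in \<open>T - S\<close>. These are comparable,
    which contradicts that \<open>S\<close> and \<open>T\<close> are up-sets.\<close>
  have "x \<in> upset_imp X R S T \<or> x \<in> upset_imp X R T S" if x: "x \<in> X" for x
  proof (rule ccontr)
    assume "\<not> ?thesis"
    then obtain y z where "y \<in> X" "R x y" "y \<in> S" "y \<notin> T" "z \<in> X" "R x z" "z \<in> T" "z \<notin> S"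
      using x unfolding upset_imp_def by blast
    then show False using branch[of x y z] x ST by (auto simp: upsets_carrier)
  qed
  then have "upset_imp X R S T \<union> upset_imp X R T S = X" by (auto simp: upset_imp_def)
  moreover have "upset_imp X R S T \<in> carrier U" "upset_imp X R T S \<in> carrier U"
    by (rule upset_imp_closed)+
  ultimately show "(S \<Rrightarrow>\<^bsub>U\<^esub> T) \<squnion>\<^bsub>U\<^esub> (T \<Rrightarrow>\<^bsub>U\<^esub> S) = \<top>\<^bsub>U\<^esub>" using ST by simp
qed

end

section \<open>Prime filters of Goedel algebras\<close>

context godel_algebra
begin

interpretation bounded_distributive_lattice L by (rule bounded_distributive)

text \<open>Left to right is modus ponens. Conversely, if \<open>x \<Rrightarrow> y\<close> is not
  in \<open>p\<close>, then by residuation the filter \<open>A\<close> generated by \<open>p\<close>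
  and \<open>x\<close> misses \<open>y\<close>, and so does some prime extending it.\<close>

lemma prime_filters_imp:
  assumes p: "p \<in> prime_filters L" and xy: "x \<in> carrier L" "y \<in> carrier L"
  shows "x \<Rrightarrow> y \<in> p \<longleftrightarrow> (\<forall>q \<in> prime_filters L. p \<subseteq> q \<longrightarrow> x \<in> q \<longrightarrow> y \<in> q)"
proof
  assume i: "x \<Rrightarrow> y \<in> p"
  have "x \<sqinter> (x \<Rrightarrow> y) \<sqsubseteq> y" using xy by (simp add: meet_le_iff_le_imp)
  then show "\<forall>q \<in> prime_filters L. p \<subseteq> q \<longrightarrow> x \<in> q \<longrightarrow> y \<in> q"
    using i xy le_iff_prime[of "x \<sqinter> (x \<Rrightarrow> y)" y] by auto
next
  assume r: "\<forall>q \<in> prime_filters L. p \<subseteq> q \<longrightarrow> x \<in> q \<longrightarrow> y \<in> q"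
  show "x \<Rrightarrow> y \<in> p"
  proof (rule ccontr)
    assume n: "x \<Rrightarrow> y \<notin> p"
    define A where "A = {w \<in> carrier L. \<exists>f \<in> p. x \<sqinter> f \<sqsubseteq> w}"
    have AI: "w \<in> A" if "f \<in> p" "x \<sqinter> f \<sqsubseteq> w" "w \<in> carrier L" for f w
      using that by (auto simp: A_def)
    have AE: "w \<in> carrier L \<and> (\<exists>f \<in> carrier L. f \<in> p \<and> x \<sqinter> f \<sqsubseteq> w)" if "w \<in> A" for w
      using that prime_filters_sub[OF p] by (auto simp: A_def)
    have pc: "f \<in> carrier L" if "f \<in> p" for f using that prime_filters_sub[OF p] by blast
    have "\<exists>q \<in> prime_filters L. A \<subseteq> q \<and> y \<notin> q"
    proof (rule prime_between)
      show "A \<noteq> {}" using AI[of \<top> \<top>] p xy by auto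
      fix v w assume "v \<in> A" "w \<in> A"
      from this[THEN AE] obtain f g where fg: "f \<in> p" "g \<in> p" "x \<sqinter> f \<sqsubseteq> v" "x \<sqinter> g \<sqsubseteq> w"
        and c: "v \<in> carrier L" "w \<in> carrier L" "f \<in> carrier L" "g \<in> carrier L" by blast
      have "x \<sqinter> (f \<sqinter> g) \<sqsubseteq> x \<sqinter> f" "x \<sqinter> (f \<sqinter> g) \<sqsubseteq> x \<sqinter> g"
        using c xy by (simp_all add: meet_mono meet_left meet_right)
      then have "x \<sqinter> (f \<sqinter> g) \<sqsubseteq> v" "x \<sqinter> (f \<sqinter> g) \<sqsubseteq> w"
        using c xy fg le_trans[of "x \<sqinter> (f \<sqinter> g)" "x \<sqinter> f" v]
          le_trans[of "x \<sqinter> (f \<sqinter> g)" "x \<sqinter> g" w] by simp_all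
      then have "x \<sqinter> (f \<sqinter> g) \<sqsubseteq> v \<sqinter> w" using c xy by (simp add: meet_le)
      then show "v \<sqinter> w \<in> A" using c fg p by (intro AI[of "f \<sqinter> g"]) simp_all
    next
      fix w assume "w \<in> A"
      from AE[OF this] obtain f where f: "f \<in> p" "x \<sqinter> f \<sqsubseteq> w" "w \<in> carrier L" "f \<in> carrier L" by blast
      show "\<not> w \<sqsubseteq> y"
      proof
        assume "w \<sqsubseteq> y"
        then have "x \<sqinter> f \<sqsubseteq> y" using f xy le_trans[of "x \<sqinter> f" w y] by simp
        then have "f \<sqsubseteq> x \<Rrightarrow> y" using f xy by (simp add: meet_le_iff_le_imp)
        then show False using prime_filters_up[OF p] f n xy by simp
      qed
    qed (use xy AE in auto)
    then obtain q where q: "q \<in> prime_filters L" "A \<subseteq> q" "y \<notin> q" by blast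
    have "p \<subseteq> q"
    proof
      fix f assume f: "f \<in> p"
      then show "f \<in> q" using subsetD[OF q(2) AI, of f f] pc[OF f] meet_right[OF xy(1)] by blast
    qed
    moreover have "x \<in> q"
      using q(2) AI[of \<top> x] p xy meet_left[of x \<top>] by auto
    ultimately show False using r q by blast
  qed
qed

text \<open>For \<open>x \<in> q - r\<close> and \<open>y \<in> r - q\<close>, prelinearity and
  primality put \<open>x \<Rrightarrow> y\<close> or \<open>y \<Rrightarrow> x\<close> into
  \<open>p\<close>; this forces \<open>y \<in> q\<close> or \<open>x \<in> r\<close>.\<close>

lemma prime_filters_forest: "forest (prime_filters L) (\<subseteq>)"
proof
  fix p q r assume p: "p \<in> prime_filters L" "q \<in> prime_filters L" "r \<in> prime_filters L" "p \<subseteq> q" "p \<subseteq> r"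
  show "q \<subseteq> r \<or> r \<subseteq> q"
  proof (rule ccontr)
    assume "\<not> ?thesis"
    then obtain x y where xy: "x \<in> q" "x \<notin> r" "y \<in> r" "y \<notin> q" by blast
    then have c: "x \<in> carrier L" "y \<in> carrier L" using p prime_filters_sub by blast+
    have "(x \<Rrightarrow> y) \<squnion> (y \<Rrightarrow> x) \<in> p" using p c by (simp add: prelinear)
    then have "x \<Rrightarrow> y \<in> p \<or> y \<Rrightarrow> x \<in> p" using p c by simp
    then show False using p xy c by (auto simp: prime_filters_imp)
  qed
qed auto

lemma prime_representation:
  "(\<lambda>x. {p \<in> prime_filters L. x \<in> p}) \<in> heyting_homs L (upsets (prime_filters L) (\<subseteq>))"
proof -
  interpret F: forest "prime_filters L" "(\<subseteq>)" by (rule prime_filters_forest)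
  have c: "{p \<in> prime_filters L. x \<in> p} \<in> carrier F.U" for x
    by (auto simp: upsets_carrier)
  show ?thesis
    using c by (auto simp: heyting_homs_def lattice_homs_def join_pres_def meet_pres_def
        lattice_axioms F.U.lattice_axioms prime_filters_imp upset_imp_def)
qed

end

section \<open>The algebra of chains of prime filters\<close>

definition prime_chains :: "('a, 'c) gorder_scheme \<Rightarrow> 'a set set set"
  where "prime_chains L = {C. C \<subseteq> prime_filters L \<and> C \<noteq> {} \<and> (\<forall>x \<in> C. \<forall>y \<in> C. x \<subseteq> y \<or> y \<subseteq> x)}"

text \<open>In the forest of chains the smaller chain is the higher point: \<open>D\<close> is an
  up-set of the linear order \<open>C\<close>.\<close>

definition segment :: "'a set set \<Rightarrow> 'a set set \<Rightarrow> bool"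
  where "segment C D \<longleftrightarrow> D \<subseteq> C \<and> (\<forall>x \<in> D. \<forall>y \<in> C. x \<subseteq> y \<longrightarrow> y \<in> D)"

definition trace :: "'a set \<Rightarrow> 'a set set \<Rightarrow> 'a set set"
  where "trace F C = (\<lambda>x. x \<inter> F) ` C"

text \<open>One implication amounts to an equivalence because \<open>C\<close> and \<open>D\<close>
  range over all pairs of chains.\<close>

definition determined :: "('a, 'c) gorder_scheme \<Rightarrow> 'a set \<Rightarrow> 'a set set set \<Rightarrow> bool"
  where "determined L F W \<longleftrightarrow>
    (\<forall>C \<in> prime_chains L. \<forall>D \<in> prime_chains L. trace F C = trace F D \<longrightarrow> C \<in> W \<longrightarrow> D \<in> W)"

definition chain_algebra :: "('a, 'c) gorder_scheme \<Rightarrow> 'a set set set gorder"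
  where "chain_algebra L = \<lparr>carrier = {W \<in> carrier (upsets (prime_chains L) segment).
      \<exists>F. finite F \<and> F \<subseteq> carrier L \<and> determined L F W}, eq = (=), le = (\<subseteq>)\<rparr>"

definition chain_unit :: "('a, 'c) gorder_scheme \<Rightarrow> 'a \<Rightarrow> 'a set set set"
  where "chain_unit L a = {C \<in> prime_chains L. \<forall>x \<in> C. a \<in> x}"

lemma prime_chains_iff:
  "C \<in> prime_chains L \<longleftrightarrow> C \<subseteq> prime_filters L \<and> C \<noteq> {} \<and> (\<forall>x \<in> C. \<forall>y \<in> C. x \<subseteq> y \<or> y \<subseteq> x)"
  by (simp add: prime_chains_def)

lemma prime_chains_filter: "\<lbrakk>C \<in> prime_chains L; x \<in> C\<rbrakk> \<Longrightarrow> x \<in> prime_filters L"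
  unfolding prime_chains_def by blast

lemma prime_chains_linear: "\<lbrakk>C \<in> prime_chains L; x \<in> C; y \<in> C\<rbrakk> \<Longrightarrow> x \<subseteq> y \<or> y \<subseteq> x"
  unfolding prime_chains_def by blast

lemma prime_chains_subset:
  "\<lbrakk>C \<in> prime_chains L; D \<subseteq> C; D \<noteq> {}\<rbrakk> \<Longrightarrow> D \<in> prime_chains L"
  unfolding prime_chains_def by blast

lemma prime_chains_singleton: "x \<in> prime_filters L \<Longrightarrow> {x} \<in> prime_chains L"
  by (simp add: prime_chains_iff)

lemma above_prime_chain:
  "\<lbrakk>C \<in> prime_chains L; x \<in> C\<rbrakk> \<Longrightarrow> {y \<in> C. x \<subseteq> y} \<in> prime_chains L"
  by (rule prime_chains_subset) auto

lemma above_segment: "segment C {y \<in> C. x \<subseteq> y}"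
  unfolding segment_def by blast

text \<open>Branching holds because two up-sets of one linear order are nested.\<close>

lemma prime_chains_forest: "forest (prime_chains L) segment"
proof
  show "segment C C" for C by (simp add: segment_def)
  show "segment B D" if "segment B C" "segment C D" for B C D
    using that unfolding segment_def by blast
  fix C D E assume C: "C \<in> prime_chains L" "segment C D" "segment C E"
  show "segment D E \<or> segment E D"
  proof (cases "D \<subseteq> E")
    case True
    then show ?thesis using C unfolding segment_def by blast
  next
    case False
    then obtain x where x: "x \<in> D" "x \<notin> E" by blast
    have "y \<in> D" if y: "y \<in> E" for y
    proof -
      have "x \<in> C" "y \<in> C" using C x y unfolding segment_def by blast+
      then have "x \<subseteq> y \<or> y \<subseteq> x" using C prime_chains_linear by blast
      then show ?thesis using C x y \<open>x \<in> C\<close> \<open>y \<in> C\<close> unfolding segment_def by blast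
    qed
    then show ?thesis using C unfolding segment_def by blast
  qed
qed

lemma traceI: "x \<in> C \<Longrightarrow> x \<inter> F \<in> trace F C"
  by (simp add: trace_def)

lemma traceE: "t \<in> trace F C \<Longrightarrow> (\<And>x. x \<in> C \<Longrightarrow> t = x \<inter> F \<Longrightarrow> P) \<Longrightarrow> P"
  by (auto simp: trace_def)

lemma trace_restrict: "F \<subseteq> F' \<Longrightarrow> trace F C = (\<lambda>x. x \<inter> F) ` trace F' C"
  unfolding trace_def image_image by (rule image_cong) auto

lemma trace_mono: "\<lbrakk>F \<subseteq> F'; trace F' C = trace F' D\<rbrakk> \<Longrightarrow> trace F C = trace F D"
  by (simp add: trace_restrict)

lemma trace_Un: "trace F (C \<union> D) = trace F C \<union> trace F D"
  by (simp add: trace_def image_Un)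

lemma trace_subset: "trace F C \<subseteq> Pow F"
  by (auto simp: trace_def)

lemma determined_mono: "\<lbrakk>determined L F W; F \<subseteq> F'\<rbrakk> \<Longrightarrow> determined L F' W"
  unfolding determined_def using trace_mono[of F F'] by blast

text \<open>A chain of primes may lack a least member, but its traces on a finite \<open>F\<close>
  form a finite linear order.\<close>

lemma min_trace:
  assumes C: "C \<in> prime_chains L" and F: "finite F"
  shows "\<exists>x \<in> C. \<forall>y \<in> C. x \<inter> F \<subseteq> y \<inter> F"
proof -
  have "finite (trace F C)" using F trace_subset[of F C] by (meson finite_Pow_iff finite_subset)
  moreover have "trace F C \<noteq> {}" using C by (simp add: trace_def prime_chains_iff)
  ultimately obtain m where m: "m \<in> trace F C" "\<And>t. \<lbrakk>t \<in> trace F C; t \<subseteq> m\<rbrakk> \<Longrightarrow> m = t"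
    using finite_has_minimal[of "trace F C"] by metis
  then obtain x where x: "x \<in> C" "m = x \<inter> F" by (auto simp: trace_def)
  have "x \<inter> F \<subseteq> y \<inter> F" if y: "y \<in> C" for y
  proof -
    have "y \<inter> F \<in> trace F C" using y by (auto simp: trace_def)
    then have "y \<inter> F \<subseteq> x \<inter> F \<Longrightarrow> x \<inter> F = y \<inter> F" using m x by simp
    then show ?thesis using prime_chains_linear[OF C x(1) y] by blast
  qed
  then show ?thesis using x by blast
qed

text \<open>The back condition of a bounded morphism, up to traces on \<open>F\<close>. The segment
  of \<open>C\<close> matching \<open>E\<close> consists of all members of \<open>C\<close> whose
  trace occurs in \<open>E\<close>.\<close>

lemma segment_transfer:
  assumes C: "C \<in> prime_chains L" and D: "D \<in> prime_chains L" and tr: "trace F C = trace F D"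
    and E: "E \<in> prime_chains L" "segment D E"
  shows "\<exists>E' \<in> prime_chains L. segment C E' \<and> trace F E' = trace F E"
proof -
  define E' where "E' = {x \<in> C. x \<inter> F \<in> trace F E}"
  have "trace F E \<subseteq> trace F D"
    using E(2) unfolding segment_def trace_def by (intro image_mono) simp
  then have "trace F E \<subseteq> trace F C" by (simp only: tr)
  have tE: "trace F E' = trace F E"
  proof
    show "trace F E' \<subseteq> trace F E" by (auto simp: E'_def elim!: traceE)
    show "trace F E \<subseteq> trace F E'"
    proof
      fix t assume t: "t \<in> trace F E"
      with \<open>trace F E \<subseteq> trace F C\<close> have "t \<in> trace F C" by (rule subsetD)
      then obtain x where "x \<in> C" "t = x \<inter> F" by (rule traceE)
      with t show "t \<in> trace F E'" by (simp add: E'_def traceI)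
    qed
  qed
  have "E' \<noteq> {}" using tE E by (auto simp: trace_def prime_chains_iff)
  then have "E' \<in> prime_chains L"
    using C by (intro prime_chains_subset[OF C]) (auto simp: E'_def)
  moreover have step: "y \<in> E'" if x: "x \<in> E'" and y: "y \<in> C" "x \<subseteq> y" for x y
  proof -
    have "x \<inter> F \<in> trace F E" using x by (simp add: E'_def)
    then obtain w where w: "w \<in> E" "x \<inter> F = w \<inter> F" by (rule traceE)
    have "y \<inter> F \<in> trace F D" using tr traceI[OF y(1), of F] by simp
    then obtain z where z: "z \<in> D" "y \<inter> F = z \<inter> F" by (rule traceE)
    have "w \<in> D" using w E by (auto simp: segment_def)
    then consider "w \<subseteq> z" | "z \<subseteq> w" using prime_chains_linear[OF D _ z(1)] by blast
    then have "y \<inter> F \<in> trace F E"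
    proof cases
      case 1
      then have "z \<in> E" using E w z by (auto simp: segment_def)
      then show ?thesis using z by (simp add: traceI)
    next
      \<comment> \<open>Here \<open>w \<inter> F = x \<inter> F \<subseteq> y \<inter> F = z
        \<inter> F \<subseteq> w \<inter> F\<close>, so \<open>y\<close> has the trace of
        \<open>w\<close>, whether or not \<open>z\<close> lies in \<open>E\<close>.\<close>
      case 2
      then have "y \<inter> F = w \<inter> F" using w z y by blast
      then show ?thesis using w by (simp add: traceI)
    qed
    then show ?thesis using y by (simp add: E'_def)
  qed
  have "E' \<subseteq> C" by (auto simp: E'_def)
  then have "segment C E'" using step unfolding segment_def by blast
  ultimately show ?thesis using tE by blast
qed

lemma chain_algebra_carrier:
  "W \<in> carrier (chain_algebra L) \<longleftrightarrow> W \<in> carrier (upsets (prime_chains L) segment) \<and>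
    (\<exists>F. finite F \<and> F \<subseteq> carrier L \<and> determined L F W)"
  by (simp add: chain_algebra_def)

lemma chain_algebra_le [simp]: "le (chain_algebra L) = (\<subseteq>)"
  by (simp add: chain_algebra_def)

lemma common_support:
  assumes "V \<in> carrier (chain_algebra L)" "W \<in> carrier (chain_algebra L)"
  shows "\<exists>F. finite F \<and> F \<subseteq> carrier L \<and> determined L F V \<and> determined L F W"
proof -
  obtain F F' where "finite F" "F \<subseteq> carrier L" "determined L F V"
    "finite F'" "F' \<subseteq> carrier L" "determined L F' W"
    using assms unfolding chain_algebra_carrier by blast
  then show ?thesis
    by (intro exI[of _ "F \<union> F'"]) (auto intro: determined_mono)
qed

section \<open>Closure of the finitely determined up-sets under the Heyting operations\<close>

context
  fixes L :: "('a, 'c) gorder_scheme"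
begin

interpretation chains: forest "prime_chains L" segment
  by (rule prime_chains_forest)

text \<open>By \<open>segment_transfer\<close> a segment of \<open>D\<close> in \<open>V\<close> has
  a partner segment of \<open>C\<close> with the same traces. The partner lies in \<open>V\<close>,
  hence in \<open>W\<close>, and the traces carry membership in \<open>W\<close> back. The support
  \<open>F\<close> does not grow.\<close>

lemma determined_imp:
  assumes V: "determined L F V" and W: "determined L F W"
  shows "determined L F (upset_imp (prime_chains L) segment V W)"
  unfolding determined_def
proof (intro ballI impI)
  fix C D assume C: "C \<in> prime_chains L" and D: "D \<in> prime_chains L"
    and tr: "trace F C = trace F D" and i: "C \<in> upset_imp (prime_chains L) segment V W"
  have "E \<in> W" if E: "E \<in> prime_chains L" "segment D E" "E \<in> V" for E
  proof -
    obtain E' where E': "E' \<in> prime_chains L" "segment C E'" "trace F E' = trace F E"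
      using segment_transfer[OF C D tr E(1,2)] by blast
    then have "E' \<in> V" using V E unfolding determined_def by metis
    then have "E' \<in> W" using i E' unfolding upset_imp_def by blast
    then show ?thesis using W E E' unfolding determined_def by metis
  qed
  then show "D \<in> upset_imp (prime_chains L) segment V W" using D unfolding upset_imp_def by blast
qed

lemma chain_algebra_closed:
  assumes "V \<in> carrier (chain_algebra L)" "W \<in> carrier (chain_algebra L)"
  shows "V \<inter> W \<in> carrier (chain_algebra L)" "V \<union> W \<in> carrier (chain_algebra L)"
    "upset_imp (prime_chains L) segment V W \<in> carrier (chain_algebra L)"
proof -
  obtain F where F: "finite F" "F \<subseteq> carrier L" "determined L F V" "determined L F W"
    using common_support[OF assms] by blast
  have det: "determined L F (V \<inter> W)" "determined L F (V \<union> W)"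
    using F(3,4) unfolding determined_def by blast+
  have V: "V \<in> carrier (upsets (prime_chains L) segment)"
    and W: "W \<in> carrier (upsets (prime_chains L) segment)"
    using assms by (simp_all add: chain_algebra_carrier)
  have up: "V \<inter> W \<in> carrier (upsets (prime_chains L) segment)"
    "V \<union> W \<in> carrier (upsets (prime_chains L) segment)"
    using chains.U.meet_closed[OF V W] chains.U.join_closed[OF V W]
    by (simp_all only: chains.meet_eq[OF V W] chains.join_eq[OF V W])
  have *: "Z \<in> carrier (chain_algebra L)"
    if "Z \<in> carrier (upsets (prime_chains L) segment)" "determined L F Z" for Z
    using that F(1,2) unfolding chain_algebra_carrier by blast
  show "V \<inter> W \<in> carrier (chain_algebra L)" "V \<union> W \<in> carrier (chain_algebra L)"
    by (rule *[OF up(1) det(1)], rule *[OF up(2) det(2)])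
  show "upset_imp (prime_chains L) segment V W \<in> carrier (chain_algebra L)"
    by (rule *[OF chains.upset_imp_closed determined_imp[OF F(3,4)]])
qed

lemma chain_algebra_bounds:
  "{} \<in> carrier (chain_algebra L)" "prime_chains L \<in> carrier (chain_algebra L)"
  using chains.upsets_empty chains.upsets_full
  by (auto simp: chain_algebra_carrier determined_def)

lemma chain_algebra_sub:
  "W \<in> carrier (chain_algebra L) \<Longrightarrow> W \<in> carrier (upsets (prime_chains L) segment)"
  by (simp add: chain_algebra_carrier)

text \<open>\<open>godel_embedding\<close> applied to the identity: the chain algebra is a
  subalgebra of the Goedel algebra of all up-sets. The second claim serves to compute its operations
  as set operations.\<close>

lemma chain_algebra_godel:
  shows "godel_algebra (chain_algebra L)"
    and "(\<lambda>x. x) \<in> heyting_homs (chain_algebra L) (upsets (prime_chains L) segment)"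
proof -
  have eq: "eq (chain_algebra L) = (=)" by (simp add: chain_algebra_def)
  have sub: "(\<lambda>x. x) \<in> carrier (chain_algebra L) \<rightarrow> carrier (upsets (prime_chains L) segment)"
    by (simp add: chain_algebra_sub)
  have ops: "V \<sqinter>\<^bsub>chains.U\<^esub> W \<in> carrier (chain_algebra L)" "V \<squnion>\<^bsub>chains.U\<^esub> W \<in> carrier (chain_algebra L)"
    "V \<Rrightarrow>\<^bsub>chains.U\<^esub> W \<in> carrier (chain_algebra L)"
    if "V \<in> carrier (chain_algebra L)" "W \<in> carrier (chain_algebra L)" for V W
    using chain_algebra_closed[OF that] that[THEN chain_algebra_sub] by simp_all
  note emb = godel_embedding[where p = "\<lambda>x. x", OF chains.U.godel_algebra_axioms eq sub,
      unfolded image_ident]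
  show "godel_algebra (chain_algebra L)"
    by (rule emb(1)) (simp_all add: chain_algebra_bounds ops)
  show "(\<lambda>x. x) \<in> heyting_homs (chain_algebra L) (upsets (prime_chains L) segment)"
    by (rule emb(2)) (simp_all add: chain_algebra_bounds ops)
qed

end

context
  fixes L :: "('a, 'c) gorder_scheme"
begin

interpretation chains: forest "prime_chains L" segment
  by (rule prime_chains_forest)

lemma chain_algebra_ops:
  assumes "V \<in> carrier (chain_algebra L)" "W \<in> carrier (chain_algebra L)"
  shows "V \<sqinter>\<^bsub>chain_algebra L\<^esub> W = V \<inter> W" "V \<squnion>\<^bsub>chain_algebra L\<^esub> W = V \<union> W"
    "V \<Rrightarrow>\<^bsub>chain_algebra L\<^esub> W = upset_imp (prime_chains L) segment V W"
proof -
  note c = assms[THEN chain_algebra_sub]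
  have "V \<sqinter>\<^bsub>chain_algebra L\<^esub> W = V \<sqinter>\<^bsub>chains.U\<^esub> W" "V \<squnion>\<^bsub>chain_algebra L\<^esub> W = V \<squnion>\<^bsub>chains.U\<^esub> W"
    "V \<Rrightarrow>\<^bsub>chain_algebra L\<^esub> W = V \<Rrightarrow>\<^bsub>chains.U\<^esub> W"
    using chain_algebra_godel(2)[of L] assms
    by (simp_all add: heyting_homs_def lattice_homs_def join_pres_def meet_pres_def)
  then show "V \<sqinter>\<^bsub>chain_algebra L\<^esub> W = V \<inter> W" "V \<squnion>\<^bsub>chain_algebra L\<^esub> W = V \<union> W"
    "V \<Rrightarrow>\<^bsub>chain_algebra L\<^esub> W = upset_imp (prime_chains L) segment V W"
    using c by simp_all
qed

lemma chain_algebra_bot_top: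
  "\<bottom>\<^bsub>chain_algebra L\<^esub> = {}" "\<top>\<^bsub>chain_algebra L\<^esub> = prime_chains L"
proof -
  have "\<bottom>\<^bsub>chain_algebra L\<^esub> = \<bottom>\<^bsub>chains.U\<^esub>" "\<top>\<^bsub>chain_algebra L\<^esub> = \<top>\<^bsub>chains.U\<^esub>"
    using chain_algebra_godel(2)[of L] by (simp_all add: heyting_homs_def lattice_homs_def)
  then show "\<bottom>\<^bsub>chain_algebra L\<^esub> = {}" "\<top>\<^bsub>chain_algebra L\<^esub> = prime_chains L"
    by simp_all
qed

lemma chain_unit_closed:
  assumes "a \<in> carrier L"
  shows "chain_unit L a \<in> carrier (chain_algebra L)"
proof -
  have "D \<in> chain_unit L a" if "C \<in> chain_unit L a" "D \<in> prime_chains L" "trace {a} C = trace {a} D" for C D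
  proof -
    have "a \<in> x" if x: "x \<in> D" for x
    proof -
      have "x \<inter> {a} \<in> trace {a} C" using traceI[OF x, of "{a}"] \<open>trace {a} C = trace {a} D\<close> by simp
      then obtain y where "y \<in> C" "x \<inter> {a} = y \<inter> {a}" by (rule traceE)
      then show ?thesis using \<open>C \<in> chain_unit L a\<close> by (auto simp: chain_unit_def)
    qed
    then show ?thesis using that by (simp add: chain_unit_def)
  qed
  then have "determined L {a} (chain_unit L a)" unfolding determined_def by blast
  moreover have "chain_unit L a \<in> carrier chains.U"
    unfolding upsets_carrier chain_unit_def segment_def by blast
  ultimately show ?thesis
    using assms unfolding chain_algebra_carrier by (intro conjI exI[of _ "{a}"]) simp_all
qed

end

section \<open>The unit of the chain algebra and generation by its image\<close>

context bounded_distributive_lattice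
begin

lemma chain_unit_meet:
  assumes "a \<in> carrier L" "b \<in> carrier L"
  shows "chain_unit L (a \<sqinter> b) = chain_unit L a \<inter> chain_unit L b"
proof -
  have "(\<forall>x \<in> C. a \<sqinter> b \<in> x) \<longleftrightarrow> (\<forall>x \<in> C. a \<in> x) \<and> (\<forall>x \<in> C. b \<in> x)" if "C \<in> prime_chains L" for C
    using prime_filters_meet[OF prime_chains_filter[OF that] assms] by blast
  then show ?thesis unfolding chain_unit_def by blast
qed

text \<open>Linearity is essential: if one member of a chain omits \<open>a\<close> and another
  omits \<open>b\<close>, the smaller omits both.\<close>

lemma chain_unit_join:
  assumes ab: "a \<in> carrier L" "b \<in> carrier L"
  shows "chain_unit L (a \<squnion> b) = chain_unit L a \<union> chain_unit L b"
proof -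
  have "(\<forall>x \<in> C. a \<squnion> b \<in> x) \<longleftrightarrow> (\<forall>x \<in> C. a \<in> x) \<or> (\<forall>x \<in> C. b \<in> x)" if C: "C \<in> prime_chains L" for C
  proof
    assume r: "\<forall>x \<in> C. a \<squnion> b \<in> x"
    show "(\<forall>x \<in> C. a \<in> x) \<or> (\<forall>x \<in> C. b \<in> x)"
    proof (rule ccontr)
      assume "\<not> ?thesis"
      then obtain x y where xy: "x \<in> C" "a \<notin> x" "y \<in> C" "b \<notin> y" by blast
      then have "\<exists>z \<in> C. a \<notin> z \<and> b \<notin> z" using prime_chains_linear[OF C, of x y] by blast
      then show False using r prime_filters_join[OF prime_chains_filter[OF C] ab] by blast
    qed
  qed (use prime_filters_join[OF prime_chains_filter[OF C] ab] in blast)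
  then show ?thesis unfolding chain_unit_def by blast
qed

lemma chain_unit_bottom: "chain_unit L \<bottom> = {}"
proof -
  have False if C: "C \<in> prime_chains L" and b: "\<forall>x \<in> C. \<bottom> \<in> x" for C
  proof -
    obtain x where x: "x \<in> C" using C by (auto simp: prime_chains_iff)
    show False using prime_filters_bottom[OF prime_chains_filter[OF C x]] b x by blast
  qed
  then show ?thesis unfolding chain_unit_def by blast
qed

lemma chain_unit_top: "chain_unit L \<top> = prime_chains L"
  unfolding chain_unit_def using prime_filters_top[OF prime_chains_filter] by blast

lemma chain_unit_hom: "chain_unit L \<in> lattice_homs L (chain_algebra L)"
proof -
  interpret A: godel_algebra "chain_algebra L" by (rule chain_algebra_godel(1))
  note c = chain_unit_closed[of _ L]
  show ?thesis
    unfolding lattice_homs_def join_pres_def meet_pres_def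
  proof (intro CollectI conjI ballI lattice_axioms A.lattice_axioms Pi_I c)
    fix a b assume ab: "a \<in> carrier L" "b \<in> carrier L"
    show "chain_unit L (a \<squnion> b) = chain_unit L a \<squnion>\<^bsub>chain_algebra L\<^esub> chain_unit L b"
      unfolding chain_algebra_ops[OF c[OF ab(1)] c[OF ab(2)]] by (rule chain_unit_join[OF ab])
    show "chain_unit L (a \<sqinter> b) = chain_unit L a \<sqinter>\<^bsub>chain_algebra L\<^esub> chain_unit L b"
      unfolding chain_algebra_ops[OF c[OF ab(1)] c[OF ab(2)]] by (rule chain_unit_meet[OF ab])
  qed (auto simp only: chain_algebra_bot_top chain_unit_bottom chain_unit_top)
qed

text \<open>
  A trace \<open>s\<close> is avoided by a chain iff the chain satisfies
  \<open>\<And>s \<Rrightarrow> \<Or>(F - s)\<close>, and the trace set of no segment equals \<open>T\<close> iff avoiding all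
  traces outside \<open>T\<close> implies avoiding some trace in \<open>T\<close>.
\<close>

lemma avoid_trace:
  assumes F: "finite F" "F \<subseteq> carrier L" and s: "s \<subseteq> F"
  shows "\<exists>m \<in> carrier L. \<exists>j \<in> carrier L.
    {C \<in> prime_chains L. s \<notin> trace F C} = upset_imp (prime_chains L) segment (chain_unit L m) (chain_unit L j)"
proof -
  obtain m where m: "m \<in> carrier L" "\<And>p. p \<in> prime_filters L \<Longrightarrow> m \<in> p \<longleftrightarrow> s \<subseteq> p"
    using finite_meet_exists[OF finite_subset[OF s F(1)] subset_trans[OF s F(2)]] by blast
  obtain j where j: "j \<in> carrier L" "\<And>p. p \<in> prime_filters L \<Longrightarrow> j \<in> p \<longleftrightarrow> (F - s) \<inter> p \<noteq> {}"
    using finite_join_exists[OF finite_Diff[OF F(1)] subset_trans[OF Diff_subset F(2)], of s] by blast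
  have tr: "x \<inter> F = s \<longleftrightarrow> m \<in> x \<and> j \<notin> x" if "x \<in> prime_filters L" for x
    using m(2)[OF that] j(2)[OF that] s by blast
  have "s \<notin> trace F C \<longleftrightarrow> C \<in> upset_imp (prime_chains L) segment (chain_unit L m) (chain_unit L j)"
    if C: "C \<in> prime_chains L" for C
  proof
    assume n: "s \<notin> trace F C"
    have "D \<in> chain_unit L j" if D: "D \<in> prime_chains L" "segment C D" "D \<in> chain_unit L m" for D
    proof -
      have "j \<in> x" if x: "x \<in> D" for x
      proof -
        have "x \<in> C" using D x by (auto simp: segment_def)
        then have "x \<inter> F \<noteq> s" using n traceI[of x C F] by blast
        moreover have "m \<in> x" using D x by (simp add: chain_unit_def)
        ultimately show ?thesis using tr prime_chains_filter[OF D(1) x] by blast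
      qed
      then show ?thesis using D by (simp add: chain_unit_def)
    qed
    then show "C \<in> upset_imp (prime_chains L) segment (chain_unit L m) (chain_unit L j)"
      using C unfolding upset_imp_def by blast
  next
    assume i: "C \<in> upset_imp (prime_chains L) segment (chain_unit L m) (chain_unit L j)"
    show "s \<notin> trace F C"
    proof
      assume "s \<in> trace F C"
      then obtain x where x: "x \<in> C" "s = x \<inter> F" by (rule traceE)
      \<comment> \<open>All members of this principal segment contain \<open>x\<close> and hence
        \<open>m\<close>, while its member \<open>x\<close> omits \<open>j\<close>; so
        \<open>C\<close> violates the implication.\<close>
      let ?D = "{y \<in> C. x \<subseteq> y}"
      have mj: "m \<in> x" "j \<notin> x" using tr[OF prime_chains_filter[OF C x(1)]] x by blast+
      then have "?D \<in> chain_unit L m"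
        using above_prime_chain[OF C x(1)] by (auto simp: chain_unit_def)
      then have "?D \<in> chain_unit L j"
        using i above_prime_chain[OF C x(1)] above_segment unfolding upset_imp_def by blast
      then have "j \<in> x" using x by (simp add: chain_unit_def)
      then show False using mj by blast
    qed
  qed
  then have "{C \<in> prime_chains L. s \<notin> trace F C} = upset_imp (prime_chains L) segment (chain_unit L m) (chain_unit L j)"
    unfolding upset_imp_def by blast
  then show ?thesis using m(1) j(1) by blast
qed

text \<open>\<open>W\<close> is the intersection of the sets \<open>N T\<close> over the finitely
  many trace sets \<open>T\<close> that no member of \<open>W\<close> has; \<open>N T\<close>
  consists of the chains without a segment of trace set \<open>T\<close>. Later \<open>K\<close> is
  the range of a homomorphism that is shown to be onto.\<close>

theorem chain_algebra_generated:
  assumes unit: "\<And>a. a \<in> carrier L \<Longrightarrow> chain_unit L a \<in> K"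
    and meet: "\<And>V W. \<lbrakk>V \<in> K; W \<in> K\<rbrakk> \<Longrightarrow> V \<inter> W \<in> K"
    and join: "\<And>V W. \<lbrakk>V \<in> K; W \<in> K\<rbrakk> \<Longrightarrow> V \<union> W \<in> K"
    and imp: "\<And>V W. \<lbrakk>V \<in> K; W \<in> K\<rbrakk> \<Longrightarrow> upset_imp (prime_chains L) segment V W \<in> K"
    and W: "W \<in> carrier (chain_algebra L)"
  shows "W \<in> K"
proof -
  let ?X = "prime_chains L"
  have X: "?X \<in> K" using unit[of \<top>] by (simp add: chain_unit_top)
  have E: "{} \<in> K" using unit[of \<bottom>] by (simp add: chain_unit_bottom)
  have Inter: "{C \<in> ?X. \<forall>i \<in> I. C \<in> f i} \<in> K" if "finite I" "\<And>i. i \<in> I \<Longrightarrow> f i \<in> K" for I and f :: "'i \<Rightarrow> _"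
    using that
  proof induction
    case (insert i I)
    then have "f i \<inter> {C \<in> ?X. \<forall>i \<in> I. C \<in> f i} \<in> K" by (simp add: meet)
    also have "f i \<inter> {C \<in> ?X. \<forall>i \<in> I. C \<in> f i} = {C \<in> ?X. \<forall>i \<in> insert i I. C \<in> f i}" by blast
    finally show ?case .
  qed (simp add: X)
  have Union: "(\<Union>i \<in> I. f i) \<in> K" if "finite I" "\<And>i. i \<in> I \<Longrightarrow> f i \<in> K" for I and f :: "'i \<Rightarrow> _"
    using that by induction (simp_all add: E join)
  obtain F where F: "finite F" "F \<subseteq> carrier L" "determined L F W"
    using W unfolding chain_algebra_carrier by blast
  have up: "D \<in> W" if "C \<in> W" "D \<in> ?X" "segment C D" for C D
    using W that unfolding chain_algebra_carrier upsets_carrier by blast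
  have WX: "W \<subseteq> ?X" using W unfolding chain_algebra_carrier upsets_carrier by blast
  define M where "M s = {C \<in> ?X. s \<notin> trace F C}" for s
  have M: "M s \<in> K" if s: "s \<subseteq> F" for s
  proof -
    obtain m j where "m \<in> carrier L" "j \<in> carrier L"
      "M s = upset_imp ?X segment (chain_unit L m) (chain_unit L j)"
      using avoid_trace[OF F(1,2) s] unfolding M_def by blast
    then show ?thesis using imp[OF unit unit] by simp
  qed
  define N where "N T = upset_imp ?X segment {C \<in> ?X. \<forall>s \<in> Pow F - T. C \<in> M s} (\<Union>s \<in> T. M s)" for T
  have N: "N T \<in> K" if T: "T \<subseteq> Pow F" for T
    unfolding N_def
  proof (intro imp Inter Union)
    show "finite (Pow F - T)" "finite T" using F(1) T by (auto intro: finite_subset)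
    show "M s \<in> K" if "s \<in> Pow F - T" for s using that by (intro M) blast
    show "M s \<in> K" if "s \<in> T" for s using that T by (intro M) blast
  qed
  have N_iff: "C \<in> N T \<longleftrightarrow> (\<forall>D \<in> ?X. segment C D \<longrightarrow> trace F D \<noteq> T)"
    if C: "C \<in> ?X" and T: "T \<subseteq> Pow F" for C T
  proof -
    have "trace F D = T \<longleftrightarrow> D \<in> {C \<in> ?X. \<forall>s \<in> Pow F - T. C \<in> M s} \<and> D \<notin> (\<Union>s \<in> T. M s)"
      if "D \<in> ?X" for D
    proof -
      have "trace F D = T \<longleftrightarrow> (\<forall>s \<in> Pow F - T. s \<notin> trace F D) \<and> (\<forall>s \<in> T. s \<in> trace F D)"
        using trace_subset[of F D] T by blast
      also have "\<dots> \<longleftrightarrow> D \<in> {C \<in> ?X. \<forall>s \<in> Pow F - T. C \<in> M s} \<and> D \<notin> (\<Union>s \<in> T. M s)"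
        using that by (simp add: M_def)
      finally show ?thesis .
    qed
    then show ?thesis using C unfolding N_def upset_imp_def by blast
  qed
  define \<T> where "\<T> = Pow (Pow F) - trace F ` W"
  have "W = {C \<in> ?X. \<forall>T \<in> \<T>. C \<in> N T}"
  proof (intro equalityI subsetI)
    fix C assume C: "C \<in> W"
    have "C \<in> N T" if T: "T \<in> \<T>" for T
    proof -
      have "trace F D \<noteq> T" if D: "D \<in> ?X" "segment C D" for D
        using up[OF C D] T unfolding \<T>_def by blast
      then show ?thesis using N_iff[of C T] C WX T unfolding \<T>_def by blast
    qed
    then show "C \<in> {C \<in> ?X. \<forall>T \<in> \<T>. C \<in> N T}" using C WX by blast
  next
    fix C assume "C \<in> {C \<in> ?X. \<forall>T \<in> \<T>. C \<in> N T}"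
    then have C: "C \<in> ?X" "\<And>T. T \<in> \<T> \<Longrightarrow> C \<in> N T" by blast+
    \<comment> \<open>As \<open>C\<close> is a segment of itself, \<open>trace F C\<close> cannot be
      in \<open>\<T>\<close>. So some member of \<open>W\<close> has the traces of \<open>C\<close>,
      and \<open>F\<close> determines \<open>W\<close>.\<close>
    have "segment C C" by (simp add: segment_def)
    then have "C \<notin> N (trace F C)" using N_iff[OF C(1) trace_subset] C(1) by blast
    then have "trace F C \<in> trace F ` W" using C(2) trace_subset[of F C] unfolding \<T>_def by blast
    then obtain D where "D \<in> W" "trace F C = trace F D" by blast
    then show "C \<in> W" using F(3) C(1) WX unfolding determined_def by (metis subsetD)
  qed
  also have "\<dots> \<in> K"
    by (rule Inter) (use F(1) in \<open>auto simp: \<T>_def intro!: N\<close>)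
  finally show ?thesis .
qed

end

section \<open>The free Goedel algebra as an algebra of chains\<close>

definition chain_above ::
    "('a, 'c) gorder_scheme \<Rightarrow> ('b, 'd) gorder_scheme \<Rightarrow> ('a \<Rightarrow> 'b) \<Rightarrow> 'b set \<Rightarrow> 'a set set"
  where "chain_above L G e p =
    (\<lambda>q. {a \<in> carrier L. e a \<in> q}) ` {q \<in> prime_filters G. p \<subseteq> q}"

text \<open>An arbitrary lattice homomorphism into a Goedel algebra; freeness enters only in
  \<open>free_godel_chain_algebra\<close>.\<close>

locale godel_extension = L: bounded_distributive_lattice L + G: godel_algebra G
  for L :: "'l gorder" and G :: "'g gorder" +
  fixes e :: "'l \<Rightarrow> 'g"
  assumes hom: "e \<in> lattice_homs L G"
begin

sublocale G: bounded_distributive_lattice G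
  by (rule G.bounded_distributive)

sublocale G: forest "prime_filters G" "(\<subseteq>)"
  by (rule G.prime_filters_forest)

sublocale chains: forest "prime_chains L" segment
  by (rule prime_chains_forest)

lemma hom_closed: "a \<in> carrier L \<Longrightarrow> e a \<in> carrier G"
  using hom by (auto simp: lattice_homs_def)

abbreviation pullback :: "'g set \<Rightarrow> 'l set"
  where "pullback q \<equiv> {a \<in> carrier L. e a \<in> q}"

abbreviation chain :: "'g set \<Rightarrow> 'l set set"
  where "chain \<equiv> chain_above L G e"

lemma pullback_prime:
  assumes q: "q \<in> prime_filters G"
  shows "pullback q \<in> prime_filters L"
proof -
  have "e (a \<squnion>\<^bsub>L\<^esub> b) = e a \<squnion>\<^bsub>G\<^esub> e b" "e (a \<sqinter>\<^bsub>L\<^esub> b) = e a \<sqinter>\<^bsub>G\<^esub> e b"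
    if "a \<in> carrier L" "b \<in> carrier L" for a b
    using hom that by (simp_all add: lattice_homs_def join_pres_def meet_pres_def)
  moreover have "e \<bottom>\<^bsub>L\<^esub> = \<bottom>\<^bsub>G\<^esub>" "e \<top>\<^bsub>L\<^esub> = \<top>\<^bsub>G\<^esub>"
    using hom by (simp_all add: lattice_homs_def)
  ultimately show ?thesis
    using q by (intro prime_filtersI) (simp_all add: hom_closed)
qed

lemma chainI: "\<lbrakk>q \<in> prime_filters G; p \<subseteq> q\<rbrakk> \<Longrightarrow> pullback q \<in> chain p"
  unfolding chain_above_def by blast

lemma chainE:
  assumes "x \<in> chain p"
  obtains q where "q \<in> prime_filters G" "p \<subseteq> q" "x = pullback q"
  using assms unfolding chain_above_def by blast

lemma chain_prime_chain:
  assumes p: "p \<in> prime_filters G"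
  shows "chain p \<in> prime_chains L"
  unfolding prime_chains_iff
proof (intro conjI subsetI ballI)
  show "x \<in> prime_filters L" if "x \<in> chain p" for x
    using that by (rule chainE) (simp add: pullback_prime)
  show "chain p \<noteq> {}" using chainI[OF p subset_refl] by blast
  fix x y assume "x \<in> chain p" "y \<in> chain p"
  then obtain q r where qr: "q \<in> prime_filters G" "p \<subseteq> q" "x = pullback q"
    "r \<in> prime_filters G" "p \<subseteq> r" "y = pullback r"
    by (elim chainE) simp
  then show "x \<subseteq> y \<or> y \<subseteq> x" using G.branch[OF p qr(1) qr(4) qr(2) qr(5)] by blast
qed

text \<open>Prime filters of \<open>G\<close> above \<open>p\<close> are comparable with
  \<open>q\<close>. One below \<open>q\<close> may have the same restriction to \<open>L\<close> as
  \<open>q\<close>, which is harmless: it contributes no new member to the chain.\<close>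

lemma chain_above_eq:
  assumes p: "p \<in> prime_filters G" and q: "q \<in> prime_filters G" "p \<subseteq> q"
  shows "chain q = {y \<in> chain p. pullback q \<subseteq> y}"
proof (intro equalityI subsetI)
  fix y assume "y \<in> chain q"
  then obtain r where r: "r \<in> prime_filters G" "q \<subseteq> r" "y = pullback r" by (rule chainE)
  have "y \<in> chain p" using r(1) subset_trans[OF q(2) r(2)] unfolding r(3) by (rule chainI)
  moreover have "pullback q \<subseteq> y" using r(2,3) by blast
  ultimately show "y \<in> {y \<in> chain p. pullback q \<subseteq> y}" by blast
next
  fix y assume "y \<in> {y \<in> chain p. pullback q \<subseteq> y}"
  then have y: "y \<in> chain p" "pullback q \<subseteq> y" by blast+
  from y(1) obtain r where r: "r \<in> prime_filters G" "p \<subseteq> r" "y = pullback r" by (rule chainE)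
  consider "q \<subseteq> r" | "r \<subseteq> q" using G.branch[OF p q(1) r(1) q(2) r(2)] by blast
  then show "y \<in> chain q"
  proof cases
    case 1
    then show ?thesis using chainI r by simp
  next
    case 2
    then have "y = pullback q" using y(2) r(3) by blast
    then show ?thesis using chainI[OF q(1) subset_refl] by simp
  qed
qed

lemma segment_chain:
  "\<lbrakk>p \<in> prime_filters G; q \<in> prime_filters G; p \<subseteq> q\<rbrakk> \<Longrightarrow> segment (chain p) (chain q)"
  using above_segment by (simp only: chain_above_eq[of p q])

text \<open>
  A segment of a chain need not be of the form \<^term>\<open>chain q\<close>, but finitely many elements
  cannot tell the difference.
\<close>

lemma segment_chain_trace:
  assumes p: "p \<in> prime_filters G" and D: "D \<in> prime_chains L" "segment (chain p) D"
    and F: "finite F"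
  shows "\<exists>q \<in> prime_filters G. p \<subseteq> q \<and> trace F (chain q) = trace F D"
proof -
  \<comment> \<open>\<open>x\<close> has the least trace in \<open>D\<close> and is the restriction
    of some \<open>q\<close>. Then \<open>chain q\<close> is the part of \<open>chain p\<close>
    above \<open>x\<close>; members of \<open>D\<close> below \<open>x\<close> are lost, but they
    have the trace of \<open>x\<close>.\<close>
  obtain x where x: "x \<in> D" "\<And>y. y \<in> D \<Longrightarrow> x \<inter> F \<subseteq> y \<inter> F" using min_trace[OF D(1) F] by blast
  have Dp: "D \<subseteq> chain p" using D(2) by (simp add: segment_def)
  then have "x \<in> chain p" using x(1) by blast
  then obtain q where q: "q \<in> prime_filters G" "p \<subseteq> q" "x = pullback q" by (rule chainE)
  have eq: "chain q = {y \<in> chain p. x \<subseteq> y}" using chain_above_eq[OF p q(1,2)] q(3) by simp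
  have "trace F (chain q) = trace F D"
  proof (intro equalityI subsetI)
    fix t assume "t \<in> trace F (chain q)"
    then obtain y where y: "y \<in> chain q" "t = y \<inter> F" by (rule traceE)
    then have "y \<in> D" using D(2) x(1) unfolding eq segment_def by blast
    then show "t \<in> trace F D" unfolding y(2) by (rule traceI)
  next
    fix t assume "t \<in> trace F D"
    then obtain y where y: "y \<in> D" "t = y \<inter> F" by (rule traceE)
    consider "x \<subseteq> y" | "y \<subseteq> x" using prime_chains_linear[OF D(1) x(1) y(1)] by blast
    then show "t \<in> trace F (chain q)"
    proof cases
      case 1
      then have "y \<in> chain q" using y Dp unfolding eq by blast
      then show ?thesis unfolding y(2) by (rule traceI)
    next
      case 2
      then have "t = x \<inter> F" using x(2)[OF y(1)] y(2) by blast
      moreover have "x \<in> chain q" using \<open>x \<in> chain p\<close> unfolding eq by blast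
      ultimately show ?thesis by (simp add: traceI)
    qed
  qed
  then show ?thesis using q by blast
qed

text \<open>Inverse image along the map \<open>p \<mapsto> chain p\<close> from prime filters of
  \<open>G\<close> to chains.\<close>

definition restrict_chains :: "'l set set set \<Rightarrow> 'g set set"
  where "restrict_chains W = {p \<in> prime_filters G. chain p \<in> W}"

text \<open>Inverse images along bounded morphisms preserve implication. Here the back condition is
  only available up to traces on a finite set, which suffices because one finite \<open>F\<close>
  supports both \<open>V\<close> and \<open>W\<close>.\<close>

lemma restrict_chains_imp:
  assumes V: "V \<in> carrier (chain_algebra L)" and W: "W \<in> carrier (chain_algebra L)"
  shows "restrict_chains (upset_imp (prime_chains L) segment V W) =
    upset_imp (prime_filters G) (\<subseteq>) (restrict_chains V) (restrict_chains W)"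
proof -
  obtain F where F: "finite F" "determined L F V" "determined L F W"
    using common_support[OF V W] by blast
  have "chain p \<in> upset_imp (prime_chains L) segment V W \<longleftrightarrow>
    (\<forall>q \<in> prime_filters G. p \<subseteq> q \<longrightarrow> chain q \<in> V \<longrightarrow> chain q \<in> W)"
    if p: "p \<in> prime_filters G" for p
  proof (intro iffI ballI impI)
    fix q assume i: "chain p \<in> upset_imp (prime_chains L) segment V W"
      and q: "q \<in> prime_filters G" "p \<subseteq> q" "chain q \<in> V"
    show "chain q \<in> W"
      using i q(3) chain_prime_chain[OF q(1)] segment_chain[OF p q(1,2)] unfolding upset_imp_def by blast
  next
    assume r: "\<forall>q \<in> prime_filters G. p \<subseteq> q \<longrightarrow> chain q \<in> V \<longrightarrow> chain q \<in> W"
    have "D \<in> W" if D: "D \<in> prime_chains L" "segment (chain p) D" "D \<in> V" for D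
    proof -
      obtain q where q: "q \<in> prime_filters G" "p \<subseteq> q" "trace F (chain q) = trace F D"
        using segment_chain_trace[OF p D(1,2) F(1)] by blast
      note c = chain_prime_chain[OF q(1)]
      have "chain q \<in> V" using F(2) D(1,3) c q(3)[symmetric] unfolding determined_def by blast
      then have "chain q \<in> W" using r q by blast
      then show ?thesis using F(3) D(1) c q(3) unfolding determined_def by blast
    qed
    then show "chain p \<in> upset_imp (prime_chains L) segment V W"
      using chain_prime_chain[OF p] unfolding upset_imp_def by blast
  qed
  then show ?thesis unfolding restrict_chains_def upset_imp_def[of "prime_filters G"] by blast
qed

lemma restrict_chains_closed:
  assumes W: "W \<in> carrier (chain_algebra L)"
  shows "restrict_chains W \<in> carrier G.U"
  unfolding upsets_carrier
proof (intro conjI ballI impI)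
  fix p q assume "p \<in> restrict_chains W" and q: "q \<in> prime_filters G" "p \<subseteq> q"
  then have p: "p \<in> prime_filters G" "chain p \<in> W" by (simp_all add: restrict_chains_def)
  have "chain q \<in> W"
    using chain_algebra_sub[OF W] p(2) chain_prime_chain[OF q(1)] segment_chain[OF p(1) q]
    unfolding upsets_carrier by blast
  then show "q \<in> restrict_chains W" using q by (simp add: restrict_chains_def)
qed (simp add: restrict_chains_def)

lemma restrict_chains_hom: "restrict_chains \<in> heyting_homs (chain_algebra L) G.U"
proof -
  interpret A: godel_algebra "chain_algebra L" by (rule chain_algebra_godel(1))
  note c = restrict_chains_closed
  show ?thesis
    unfolding heyting_homs_def lattice_homs_def join_pres_def meet_pres_def
  proof (intro CollectI conjI ballI A.lattice_axioms G.U.lattice_axioms Pi_I c)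
    fix V W assume VW: "V \<in> carrier (chain_algebra L)" "W \<in> carrier (chain_algebra L)"
    note ops = chain_algebra_ops[OF VW]
    show "restrict_chains (V \<squnion>\<^bsub>chain_algebra L\<^esub> W) = restrict_chains V \<squnion>\<^bsub>G.U\<^esub> restrict_chains W"
      unfolding ops G.join_eq[OF c[OF VW(1)] c[OF VW(2)]] by (auto simp: restrict_chains_def)
    show "restrict_chains (V \<sqinter>\<^bsub>chain_algebra L\<^esub> W) = restrict_chains V \<sqinter>\<^bsub>G.U\<^esub> restrict_chains W"
      unfolding ops G.meet_eq[OF c[OF VW(1)] c[OF VW(2)]] by (auto simp: restrict_chains_def)
    show "restrict_chains (V \<Rrightarrow>\<^bsub>chain_algebra L\<^esub> W) = restrict_chains V \<Rrightarrow>\<^bsub>G.U\<^esub> restrict_chains W"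
      unfolding ops G.imp_eq[OF c[OF VW(1)] c[OF VW(2)]] by (rule restrict_chains_imp[OF VW])
  next
    show "restrict_chains \<bottom>\<^bsub>chain_algebra L\<^esub> = \<bottom>\<^bsub>G.U\<^esub>"
      unfolding chain_algebra_bot_top G.bottom_eq by (simp add: restrict_chains_def)
    show "restrict_chains \<top>\<^bsub>chain_algebra L\<^esub> = \<top>\<^bsub>G.U\<^esub>"
      unfolding chain_algebra_bot_top G.top_eq using chain_prime_chain by (auto simp: restrict_chains_def)
  qed
qed

text \<open>The least member of \<open>chain p\<close> is \<open>pullback p\<close>, so
  \<open>a\<close> lies in all members iff \<open>e a \<in> p\<close>.\<close>

lemma restrict_chains_unit:
  assumes "a \<in> carrier L"
  shows "restrict_chains (chain_unit L a) = {p \<in> prime_filters G. e a \<in> p}"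
proof -
  have "(\<forall>x \<in> chain p. a \<in> x) \<longleftrightarrow> e a \<in> p" if p: "p \<in> prime_filters G" for p
  proof
    assume "\<forall>x \<in> chain p. a \<in> x"
    from bspec[OF this chainI[OF p subset_refl]] show "e a \<in> p" by simp
  next
    assume a: "e a \<in> p"
    show "\<forall>x \<in> chain p. a \<in> x"
    proof
      fix x assume "x \<in> chain p"
      then obtain q where "p \<subseteq> q" "x = pullback q" by (rule chainE)
      then show "a \<in> x" using assms a by blast
    qed
  qed
  then show ?thesis
    unfolding restrict_chains_def chain_unit_def using chain_prime_chain by blast
qed

end

text \<open>\<open>g\<close> is the map given by the universal property. It is onto since units
  generate the chain algebra. It reflects the order since its composite with
  \<open>restrict_chains\<close> is, by uniqueness, the prime filter representation \<open>r\<close>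
  of \<open>G\<close>.\<close>

theorem free_godel_chain_algebra:
  fixes L :: "'l gorder" and G :: "'g gorder"
  assumes L: "bounded_distributive_lattice L" and free: "free_godel_algebra L G e"
  shows "\<exists>g. g ` carrier G = carrier (chain_algebra L) \<and>
    (\<forall>u \<in> carrier G. \<forall>v \<in> carrier G. u \<sqsubseteq>\<^bsub>G\<^esub> v \<longleftrightarrow> g u \<subseteq> g v)"
proof -
  interpret godel_extension L G e
    using L free by (simp add: godel_extension_def godel_extension_axioms_def free_godel_algebra_def)
  interpret A: godel_algebra "chain_algebra L" by (rule chain_algebra_godel(1))
  obtain g where g: "g \<in> heyting_homs G (chain_algebra L)" "\<And>a. a \<in> carrier L \<Longrightarrow> g (e a) = chain_unit L a"
    using free_godel_universal[OF L free A.godel_algebra_axioms L.chain_unit_hom] by blast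
  have gc: "g u \<in> carrier (chain_algebra L)" if "u \<in> carrier G" for u
    using g(1) that by (auto simp: heyting_homs_def lattice_homs_def)
  have gops: "g (u \<sqinter>\<^bsub>G\<^esub> v) = g u \<inter> g v" "g (u \<squnion>\<^bsub>G\<^esub> v) = g u \<union> g v"
    "g (u \<Rrightarrow>\<^bsub>G\<^esub> v) = upset_imp (prime_chains L) segment (g u) (g v)"
    if uv: "u \<in> carrier G" "v \<in> carrier G" for u v
    unfolding chain_algebra_ops[OF gc[OF uv(1)] gc[OF uv(2)], symmetric]
    using g(1) uv by (simp_all add: heyting_homs_def lattice_homs_def join_pres_def meet_pres_def)
  have "carrier (chain_algebra L) \<subseteq> g ` carrier G"
  proof
    fix W assume W: "W \<in> carrier (chain_algebra L)"
    show "W \<in> g ` carrier G"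
    proof (rule L.chain_algebra_generated[OF _ _ _ _ W])
      fix a assume a: "a \<in> carrier L"
      then show "chain_unit L a \<in> g ` carrier G"
        unfolding g(2)[OF a, symmetric] by (intro imageI hom_closed)
    next
      fix V W assume "V \<in> g ` carrier G" "W \<in> g ` carrier G"
      then obtain u v where uv: "u \<in> carrier G" "v \<in> carrier G" "V = g u" "W = g v" by blast
      show "V \<inter> W \<in> g ` carrier G" "V \<union> W \<in> g ` carrier G"
        "upset_imp (prime_chains L) segment V W \<in> g ` carrier G"
        unfolding uv(3,4) gops[OF uv(1,2), symmetric] using uv by (simp_all only: imageI G.meet_closed G.join_closed G.imp_closed)
    qed
  qed
  moreover have "g ` carrier G \<subseteq> carrier (chain_algebra L)" using gc by blast
  ultimately have surj: "g ` carrier G = carrier (chain_algebra L)" by blast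
  define r where "r = (\<lambda>u. {p \<in> prime_filters G. u \<in> p})"
  have r: "r \<in> heyting_homs G G.U" unfolding r_def by (rule G.prime_representation)
  have unit: "restrict_chains (g (e a)) = r (e a)" if "a \<in> carrier L" for a
    using restrict_chains_unit[OF that] g(2)[OF that] by (simp add: r_def)
  have re: "(\<lambda>a. r (e a)) \<in> lattice_homs L G.U"
    using hom r hom_closed by (auto simp: heyting_homs_def lattice_homs_def join_pres_def meet_pres_def Pi_iff)
  have id: "(\<lambda>u. u) \<in> heyting_homs G.U G.U"
    by (simp add: heyting_homs_def lattice_homs_def join_pres_def meet_pres_def G.U.lattice_axioms)
  \<comment> \<open>Both sides extend \<open>\<lambda>a. r (e a)\<close>. Uniqueness concerns
    extensional maps, so both are cut down to \<open>carrier G\<close>, \<open>r\<close> by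
    composing it with the identity.\<close>
  have "compose (carrier G) restrict_chains g = compose (carrier G) (\<lambda>u. u) r"
  proof (rule ex1E[OF free_godel_universal[OF L free G.U.godel_algebra_axioms re]])
    fix h assume h: "\<forall>k. k \<in> extensional (carrier G) \<and> k \<in> heyting_homs G G.U \<and>
        (\<forall>a \<in> carrier L. k (e a) = r (e a)) \<longrightarrow> k = h"
    have "compose (carrier G) restrict_chains g = h"
      using heyting_homs_comp[OF g(1) restrict_chains_hom G.heyting_algebra_axioms] unit
      by (intro h[rule_format] conjI ballI) (simp_all add: compose_eq hom_closed)
    moreover have "compose (carrier G) (\<lambda>u. u) r = h"
      using heyting_homs_comp[OF r id G.heyting_algebra_axioms]
      by (intro h[rule_format] conjI ballI) (simp_all add: compose_eq hom_closed)
    ultimately show ?thesis by simp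
  qed
  then have rg: "restrict_chains (g u) = r u" if "u \<in> carrier G" for u
    using that by (metis compose_eq)
  have "u \<sqsubseteq>\<^bsub>G\<^esub> v \<longleftrightarrow> g u \<subseteq> g v" if uv: "u \<in> carrier G" "v \<in> carrier G" for u v
  proof
    assume "u \<sqsubseteq>\<^bsub>G\<^esub> v"
    then have "u \<squnion>\<^bsub>G\<^esub> v = v" using uv G.le_iff_meet by blast
    then show "g u \<subseteq> g v" using gops(2)[OF uv] by auto
  next
    assume "g u \<subseteq> g v"
    then have "r u \<subseteq> r v" unfolding rg[OF uv(1), symmetric] rg[OF uv(2), symmetric] restrict_chains_def by blast
    then show "u \<sqsubseteq>\<^bsub>G\<^esub> v" unfolding G.le_iff_prime[OF uv] r_def by blast
  qed
  then show ?thesis using surj by blast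
qed

section \<open>Co-implications in the algebra of chains\<close>

text \<open>Joins and least elements depend only on the order, which \<open>g\<close> preserves and
  reflects, so co-implications correspond along \<open>g\<close>.\<close>

lemma co_heyting_order_iso:
  assumes A: "bounded_distributive_lattice A" and B: "bounded_distributive_lattice B"
    and surj: "g ` carrier A = carrier B"
    and le: "\<And>u v. \<lbrakk>u \<in> carrier A; v \<in> carrier A\<rbrakk> \<Longrightarrow> u \<sqsubseteq>\<^bsub>A\<^esub> v \<longleftrightarrow> g u \<sqsubseteq>\<^bsub>B\<^esub> g v"
  shows "co_heyting_algebra A \<longleftrightarrow> co_heyting_algebra B"
proof -
  interpret A: bounded_distributive_lattice A by (rule A)
  interpret B: bounded_distributive_lattice B by (rule B)
  have gc: "g u \<in> carrier B" if "u \<in> carrier A" for u using surj that by blast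
  have join: "g (u \<squnion>\<^bsub>A\<^esub> v) = g u \<squnion>\<^bsub>B\<^esub> g v" if uv: "u \<in> carrier A" "v \<in> carrier A" for u v
  proof (rule B.join_eqI[symmetric])
    show "is_lub B (g (u \<squnion>\<^bsub>A\<^esub> v)) {g u, g v}"
    proof (rule least_UpperI)
      fix x assume "x \<in> {g u, g v}"
      then show "x \<sqsubseteq>\<^bsub>B\<^esub> g (u \<squnion>\<^bsub>A\<^esub> v)"
        using uv by (auto simp: le[symmetric] A.join_left A.join_right)
    next
      fix y assume "y \<in> Upper B {g u, g v}"
      then have y: "y \<in> carrier B" "g u \<sqsubseteq>\<^bsub>B\<^esub> y" "g v \<sqsubseteq>\<^bsub>B\<^esub> y"
        using gc uv by (auto simp: Upper_def)
      then obtain w where w: "w \<in> carrier A" "y = g w" using surj by blast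
      then show "g (u \<squnion>\<^bsub>A\<^esub> v) \<sqsubseteq>\<^bsub>B\<^esub> y"
        using y uv by (simp add: le[symmetric] A.join_le)
    qed (use gc uv in auto)
  qed
  have least: "least A z {w \<in> carrier A. b \<sqsubseteq>\<^bsub>A\<^esub> a \<squnion>\<^bsub>A\<^esub> w} \<longleftrightarrow>
      least B (g z) {w \<in> carrier B. g b \<sqsubseteq>\<^bsub>B\<^esub> g a \<squnion>\<^bsub>B\<^esub> w}"
    if c: "a \<in> carrier A" "b \<in> carrier A" "z \<in> carrier A" for a b z
  proof -
    have iff: "b \<sqsubseteq>\<^bsub>A\<^esub> a \<squnion>\<^bsub>A\<^esub> w \<longleftrightarrow> g b \<sqsubseteq>\<^bsub>B\<^esub> g a \<squnion>\<^bsub>B\<^esub> g w" if "w \<in> carrier A" for w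
      using c that by (simp add: le join)
    have "(\<forall>w \<in> carrier A. b \<sqsubseteq>\<^bsub>A\<^esub> a \<squnion>\<^bsub>A\<^esub> w \<longrightarrow> z \<sqsubseteq>\<^bsub>A\<^esub> w) \<longleftrightarrow>
        (\<forall>w \<in> carrier A. g b \<sqsubseteq>\<^bsub>B\<^esub> g a \<squnion>\<^bsub>B\<^esub> g w \<longrightarrow> g z \<sqsubseteq>\<^bsub>B\<^esub> g w)"
      by (intro ball_cong refl) (simp only: iff le[OF c(3)])
    moreover have "least A z {w \<in> carrier A. b \<sqsubseteq>\<^bsub>A\<^esub> a \<squnion>\<^bsub>A\<^esub> w} \<longleftrightarrow> b \<sqsubseteq>\<^bsub>A\<^esub> a \<squnion>\<^bsub>A\<^esub> z \<and>
        (\<forall>w \<in> carrier A. b \<sqsubseteq>\<^bsub>A\<^esub> a \<squnion>\<^bsub>A\<^esub> w \<longrightarrow> z \<sqsubseteq>\<^bsub>A\<^esub> w)"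
      using c(3) unfolding least_def by blast
    moreover have "least B (g z) {w \<in> carrier B. g b \<sqsubseteq>\<^bsub>B\<^esub> g a \<squnion>\<^bsub>B\<^esub> w} \<longleftrightarrow>
        g b \<sqsubseteq>\<^bsub>B\<^esub> g a \<squnion>\<^bsub>B\<^esub> g z \<and>
        (\<forall>w \<in> carrier A. g b \<sqsubseteq>\<^bsub>B\<^esub> g a \<squnion>\<^bsub>B\<^esub> g w \<longrightarrow> g z \<sqsubseteq>\<^bsub>B\<^esub> g w)"
      using c(3) unfolding least_def surj[symmetric] by blast
    ultimately show ?thesis using iff[OF c(3)] by (simp only:)
  qed
  show ?thesis
    unfolding A.co_heyting_iff B.co_heyting_iff
  proof (intro iffI ballI)
    fix a b assume r: "\<forall>a \<in> carrier A. \<forall>b \<in> carrier A. \<exists>z. least A z {w \<in> carrier A. b \<sqsubseteq>\<^bsub>A\<^esub> a \<squnion>\<^bsub>A\<^esub> w}"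
      and "a \<in> carrier B" "b \<in> carrier B"
    then have "a \<in> g ` carrier A" "b \<in> g ` carrier A" by (simp_all add: surj)
    then obtain a' b' where c: "a' \<in> carrier A" "b' \<in> carrier A" "a = g a'" "b = g b'"
      by (elim imageE) simp
    obtain z where z: "least A z {w \<in> carrier A. b' \<sqsubseteq>\<^bsub>A\<^esub> a' \<squnion>\<^bsub>A\<^esub> w}"
      using bspec[OF bspec[OF r c(1)] c(2)] by blast
    have "least B (g z) {w \<in> carrier B. b \<sqsubseteq>\<^bsub>B\<^esub> a \<squnion>\<^bsub>B\<^esub> w}"
      using z least[OF c(1,2) least_closed[OF z]] by (simp add: c(3,4))
    then show "\<exists>z. least B z {w \<in> carrier B. b \<sqsubseteq>\<^bsub>B\<^esub> a \<squnion>\<^bsub>B\<^esub> w}" by (rule exI)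
  next
    fix a b assume r: "\<forall>a \<in> carrier B. \<forall>b \<in> carrier B. \<exists>z. least B z {w \<in> carrier B. b \<sqsubseteq>\<^bsub>B\<^esub> a \<squnion>\<^bsub>B\<^esub> w}"
      and c: "a \<in> carrier A" "b \<in> carrier A"
    obtain z where z: "least B z {w \<in> carrier B. g b \<sqsubseteq>\<^bsub>B\<^esub> g a \<squnion>\<^bsub>B\<^esub> w}"
      using bspec[OF bspec[OF r gc[OF c(1)]] gc[OF c(2)]] by blast
    then have "z \<in> g ` carrier A" unfolding surj by (rule least_closed)
    then obtain z' where z': "z' \<in> carrier A" "z = g z'" by (elim imageE) simp
    have "least A z' {w \<in> carrier A. b \<sqsubseteq>\<^bsub>A\<^esub> a \<squnion>\<^bsub>A\<^esub> w}"
      using z least[OF c z'(1)] by (simp add: z'(2))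
    then show "\<exists>z. least A z {w \<in> carrier A. b \<sqsubseteq>\<^bsub>A\<^esub> a \<squnion>\<^bsub>A\<^esub> w}" by (rule exI)
  qed
qed

section \<open>Co-implication in the chain algebra of a co-Heyting algebra\<close>

context bounded_distributive_lattice
begin

lemma le_join_iff_prime:
  assumes "a \<in> carrier L" "b \<in> carrier L" "c \<in> carrier L"
  shows "b \<sqsubseteq> a \<squnion> c \<longleftrightarrow> (\<forall>p \<in> prime_filters L. b \<in> p \<longrightarrow> a \<in> p \<or> c \<in> p)"
  using assms by (simp add: le_iff_prime)

text \<open>The co-implication \<open>d\<close> describes the up-closure of the set of primes
  containing \<open>b\<close> and omitting \<open>a\<close>: one inclusion is
  \<open>prime_below\<close>, the other follows from
  \<open>b \<sqsubseteq> a \<squnion> d\<close>.\<close>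

lemma co_imp_prime:
  assumes co: "co_heyting_algebra L" and ab: "a \<in> carrier L" "b \<in> carrier L"
  shows "\<exists>d \<in> carrier L. \<forall>q \<in> prime_filters L.
    d \<in> q \<longleftrightarrow> (\<exists>p \<in> prime_filters L. p \<subseteq> q \<and> b \<in> p \<and> a \<notin> p)"
proof -
  obtain d where d: "least L d {w \<in> carrier L. b \<sqsubseteq> a \<squnion> w}"
    using co ab unfolding co_heyting_iff by blast
  have dc: "d \<in> carrier L" using d by (rule least_closed)
  have bd: "b \<sqsubseteq> a \<squnion> d" using least_mem[OF d] by simp
  have "d \<in> q \<longleftrightarrow> (\<exists>p \<in> prime_filters L. p \<subseteq> q \<and> b \<in> p \<and> a \<notin> p)" if q: "q \<in> prime_filters L" for q
  proof
    assume dq: "d \<in> q"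
    show "\<exists>p \<in> prime_filters L. p \<subseteq> q \<and> b \<in> p \<and> a \<notin> p"
    proof (rule prime_below[OF q ab])
      fix c assume c: "c \<in> carrier L" "b \<sqsubseteq> a \<squnion> c"
      then have "d \<sqsubseteq> c" using least_le[OF d] by simp
      then show "c \<in> q" using prime_filters_up[OF q dq _ c(1)] by blast
    qed
  next
    assume "\<exists>p \<in> prime_filters L. p \<subseteq> q \<and> b \<in> p \<and> a \<notin> p"
    then show "d \<in> q" using bd unfolding le_join_iff_prime[OF ab dc] by blast
  qed
  then show ?thesis using dc by blast
qed

text \<open>
  Adding a new top element to a chain of primes below \<open>x\<close> amounts to one co-implication, so in a
  co-Heyting algebra \<open>chain_below F T x\<close> is a condition of the form \<open>c \<in> x\<close>.
\<close>

definition chain_below :: "'a set \<Rightarrow> 'a set set \<Rightarrow> 'a set \<Rightarrow> bool"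
  where "chain_below F T x \<longleftrightarrow> (\<exists>B \<subseteq> prime_filters L.
    (\<forall>y \<in> B. \<forall>z \<in> B. y \<subseteq> z \<or> z \<subseteq> y) \<and> (\<forall>y \<in> B. y \<subseteq> x) \<and> trace F B = T)"

lemma chain_belowI:
  assumes "B \<subseteq> prime_filters L" "\<And>y z. \<lbrakk>y \<in> B; z \<in> B\<rbrakk> \<Longrightarrow> y \<subseteq> z \<or> z \<subseteq> y"
    "\<And>y. y \<in> B \<Longrightarrow> y \<subseteq> x" "trace F B = T"
  shows "chain_below F T x"
  unfolding chain_below_def using assms by (intro exI[of _ B] conjI ballI) simp_all

lemma chain_below_max:
  assumes t: "t \<in> T" "\<And>t'. t' \<in> T \<Longrightarrow> t' \<subseteq> t"
  shows "chain_below F T x \<longleftrightarrow>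
    (\<exists>y \<in> prime_filters L. y \<subseteq> x \<and> y \<inter> F = t \<and> chain_below F (T - {t}) y)"
proof
  assume "chain_below F T x"
  then obtain B where B': "B \<subseteq> prime_filters L" "\<forall>y \<in> B. \<forall>z \<in> B. y \<subseteq> z \<or> z \<subseteq> y"
    "\<forall>y \<in> B. y \<subseteq> x" "trace F B = T"
    unfolding chain_below_def by blast
  note B = B'(1) B'(2,3)[rule_format] B'(4)
  from t(1) B(4) have "t \<in> trace F B" by simp
  then obtain y where y: "y \<in> B" "t = y \<inter> F" by (rule traceE)
  have "chain_below F (T - {t}) y"
  proof (rule chain_belowI)
    show "{z \<in> B. z \<inter> F \<noteq> t} \<subseteq> prime_filters L" using B(1) by blast
    show "trace F {z \<in> B. z \<inter> F \<noteq> t} = T - {t}"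
      unfolding B(4)[symmetric] trace_def by blast
    fix z assume "z \<in> {z \<in> B. z \<inter> F \<noteq> t}"
    then have z: "z \<in> B" "z \<inter> F \<noteq> t" by simp_all
    have "z \<inter> F \<in> T" using traceI[OF z(1), of F] B(4) by simp
    then have "z \<inter> F \<subseteq> t" by (rule t(2))
    then show "z \<subseteq> y" using B(2)[OF z(1) y(1)] z(2) y(2) by blast
  next
    fix w z assume "w \<in> {z \<in> B. z \<inter> F \<noteq> t}" "z \<in> {z \<in> B. z \<inter> F \<noteq> t}"
    then show "w \<subseteq> z \<or> z \<subseteq> w" using B(2)[of w z] by simp
  qed
  then show "\<exists>y \<in> prime_filters L. y \<subseteq> x \<and> y \<inter> F = t \<and> chain_below F (T - {t}) y"
    using subsetD[OF B(1) y(1)] B(3)[OF y(1)] y(2) by blast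
next
  assume "\<exists>y \<in> prime_filters L. y \<subseteq> x \<and> y \<inter> F = t \<and> chain_below F (T - {t}) y"
  then obtain y where y: "y \<in> prime_filters L" "y \<subseteq> x" "y \<inter> F = t" "chain_below F (T - {t}) y"
    by blast
  from y(4) obtain B where B': "B \<subseteq> prime_filters L" "\<forall>y \<in> B. \<forall>z \<in> B. y \<subseteq> z \<or> z \<subseteq> y"
    "\<forall>z \<in> B. z \<subseteq> y" "trace F B = T - {t}"
    unfolding chain_below_def by (elim exE conjE) (rule that)
  note B = B'(1) B'(2,3)[rule_format] B'(4)
  show "chain_below F T x"
  proof (rule chain_belowI)
    have "trace F (insert y B) = insert t (trace F B)" using y(3) by (simp add: trace_def)
    then show "trace F (insert y B) = T" using B(4) t(1) by (simp add: insert_absorb)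
    show "insert y B \<subseteq> prime_filters L" using y(1) B(1) by simp
    show "w \<subseteq> x" if "w \<in> insert y B" for w using B(3)[of w] y(2) that by auto
    show "w \<subseteq> z \<or> z \<subseteq> w" if "w \<in> insert y B" "z \<in> insert y B" for w z
      using B(2)[of w z] B(3)[of w] B(3)[of z] that by auto
  qed
qed

text \<open>The traces of a chain are linearly ordered, so a finite nonempty set of them has a
  largest element.\<close>

lemma chain_below_no_max:
  assumes "finite T" "T \<noteq> {}" "\<And>t. t \<in> T \<Longrightarrow> \<exists>t' \<in> T. \<not> t' \<subseteq> t"
  shows "\<not> chain_below F T x"
proof
  assume "chain_below F T x"
  then obtain B where B': "\<forall>y \<in> B. \<forall>z \<in> B. y \<subseteq> z \<or> z \<subseteq> y" "trace F B = T"
    unfolding chain_below_def by blast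
  note B = B'(1)[rule_format] B'(2)
  obtain m where m: "m \<in> T" "\<forall>t \<in> T. m \<subseteq> t \<longrightarrow> m = t"
    using finite_has_maximal[OF assms(1,2)] by blast
  obtain t where t: "t \<in> T" "\<not> t \<subseteq> m" using assms(3)[OF m(1)] by blast
  obtain y z where "y \<in> B" "m = y \<inter> F" "z \<in> B" "t = z \<inter> F"
    using m(1) t(1) unfolding B(2)[symmetric] by (elim traceE) simp
  then have "t \<subseteq> m \<or> m \<subseteq> t" using B(1)[of y z] by blast
  then show False using m t by blast
qed

lemma chain_below_open:
  assumes co: "co_heyting_algebra L" and F: "finite F" "F \<subseteq> carrier L" and T: "T \<subseteq> Pow F"
  shows "\<exists>c \<in> carrier L. \<forall>x \<in> prime_filters L. c \<in> x \<longleftrightarrow> chain_below F T x"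
proof -
  have "finite T" using T F(1) by (rule finite_subset[OF _ finite_Pow_iff[THEN iffD2]])
  then show ?thesis using T
  proof (induction T rule: finite_psubset_induct)
    case (psubset T)
    consider "T = {}" | t where "t \<in> T" "\<And>t'. t' \<in> T \<Longrightarrow> t' \<subseteq> t"
      | "T \<noteq> {}" "\<And>t. t \<in> T \<Longrightarrow> \<exists>t' \<in> T. \<not> t' \<subseteq> t" by blast
    then show ?case
    proof cases
      case 1
      have "chain_below F T x" for x
        unfolding chain_below_def 1 by (rule exI[of _ "{}"]) (simp add: trace_def)
      then show ?thesis by (intro bexI[of _ \<top>]) simp_all
    next
      case 3
      then show ?thesis
        using chain_below_no_max[of T F] psubset.hyps by (intro bexI[of _ \<bottom>]) simp_all
    next
      case 2
      have tF: "t \<subseteq> F" using 2(1) psubset.prems by blast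
      have "T - {t} \<subset> T" "T - {t} \<subseteq> Pow F" using 2(1) psubset.prems by blast+
      from psubset.IH[OF this] obtain c where c: "c \<in> carrier L"
        "\<And>x. x \<in> prime_filters L \<Longrightarrow> c \<in> x \<longleftrightarrow> chain_below F (T - {t}) x" by blast
      obtain m where m: "m \<in> carrier L" "\<And>p. p \<in> prime_filters L \<Longrightarrow> m \<in> p \<longleftrightarrow> t \<subseteq> p"
        using finite_meet_exists[OF finite_subset[OF tF F(1)] subset_trans[OF tF F(2)]] by blast
      obtain j where j: "j \<in> carrier L" "\<And>p. p \<in> prime_filters L \<Longrightarrow> j \<in> p \<longleftrightarrow> (F - t) \<inter> p \<noteq> {}"
        using finite_join_exists[OF finite_Diff[OF F(1)] subset_trans[OF Diff_subset F(2)], of t] by blast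
      \<comment> \<open>\<open>m\<close> and \<open>j\<close> cut out the primes with trace
        \<open>t\<close>, and \<open>c\<close> asks for a chain with traces \<open>T - {t}\<close>
        below them. The co-implication \<open>d\<close> asks for such a prime below
        \<open>q\<close>, which is the condition in \<open>chain_below_max\<close>.\<close>
      obtain d where d: "d \<in> carrier L" "\<forall>q \<in> prime_filters L.
          d \<in> q \<longleftrightarrow> (\<exists>p \<in> prime_filters L. p \<subseteq> q \<and> c \<sqinter> m \<in> p \<and> j \<notin> p)"
        using co_imp_prime[OF co j(1) meet_closed[OF c(1) m(1)]] by (elim bexE) (rule that)
      have "c \<sqinter> m \<in> p \<and> j \<notin> p \<longleftrightarrow> p \<inter> F = t \<and> chain_below F (T - {t}) p" if p: "p \<in> prime_filters L" for p
      proof -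
        have "t \<subseteq> p \<and> \<not> (F - t) \<inter> p \<noteq> {} \<longleftrightarrow> p \<inter> F = t" using tF by blast
        then show ?thesis
          unfolding prime_filters_meet[OF p c(1) m(1)] c(2)[OF p] m(2)[OF p] j(2)[OF p] by blast
      qed
      then have "(\<exists>p \<in> prime_filters L. p \<subseteq> q \<and> c \<sqinter> m \<in> p \<and> j \<notin> p) \<longleftrightarrow> chain_below F T q" for q
        using chain_below_max[of t T F q] 2 by simp
      with d(2) have "\<forall>q \<in> prime_filters L. d \<in> q \<longleftrightarrow> chain_below F T q" by simp
      then show ?thesis using d(1) by blast
    qed
  qed
qed

text \<open>If \<open>D\<close> is a segment of \<open>C\<close>, then \<open>C - D\<close> lies
  below all members of \<open>D\<close>, and the existence of such a lower part with trace set
  \<open>T\<close> is expressed by \<open>c T\<close>. Once \<open>F'\<close> contains all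
  \<open>c T\<close>, a chain \<open>D'\<close> with the traces of \<open>D\<close> also gets a
  lower part with the traces of \<open>C - D\<close>, and extends to a member of
  \<open>W\<close>.\<close>

lemma segment_closure_determined:
  assumes co: "co_heyting_algebra L" and F: "finite F" "F \<subseteq> carrier L" and W: "determined L F W"
  shows "\<exists>F'. finite F' \<and> F' \<subseteq> carrier L \<and>
    determined L F' {D \<in> prime_chains L. \<exists>C \<in> W. C \<in> prime_chains L \<and> segment C D}"
proof -
  have "\<exists>c. c \<in> carrier L \<and> (\<forall>x \<in> prime_filters L. c \<in> x \<longleftrightarrow> chain_below F T x)"
    if "T \<in> Pow (Pow F)" for T
    using chain_below_open[OF co F PowD[OF that]] by (elim bexE) (intro exI conjI)
  then have "\<forall>T \<in> Pow (Pow F). \<exists>c. c \<in> carrier L \<and>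
      (\<forall>x \<in> prime_filters L. c \<in> x \<longleftrightarrow> chain_below F T x)" by (rule ballI)
  from bchoice[OF this] obtain c where c': "\<forall>T \<in> Pow (Pow F). c T \<in> carrier L \<and>
      (\<forall>x \<in> prime_filters L. c T \<in> x \<longleftrightarrow> chain_below F T x)"
    by (elim exE)
  have c: "c T \<in> carrier L" "\<And>x. x \<in> prime_filters L \<Longrightarrow> c T \<in> x \<longleftrightarrow> chain_below F T x"
    if "T \<in> Pow (Pow F)" for T
    using bspec[OF c' that] by simp_all
  define F' where "F' = F \<union> c ` Pow (Pow F)"
  have F': "finite F'" "F' \<subseteq> carrier L" "F \<subseteq> F'" using F c(1) by (auto simp: F'_def)
  have "\<exists>C' \<in> W. C' \<in> prime_chains L \<and> segment C' D'"
    if D: "D \<in> prime_chains L" "D' \<in> prime_chains L" "trace F' D = trace F' D'"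
      and C: "C \<in> W" "C \<in> prime_chains L" "segment C D" for C D D'
  proof -
    define B where "B = C - D"
    define T where "T = trace F B"
    have T: "T \<in> Pow (Pow F)" using trace_subset[of F B] by (simp add: T_def)
    have DC: "D \<subseteq> C" using C(3) by (simp add: segment_def)
    have "c T \<in> x" if x: "x \<in> D" for x
    proof -
      have "y \<subseteq> x" if y: "y \<in> B" for y
      proof -
        have "x \<in> C" "y \<in> C" "y \<notin> D" using x y DC by (auto simp: B_def)
        then show ?thesis using prime_chains_linear[OF C(2), of x y] C(3) x unfolding segment_def by blast
      qed
      moreover have "B \<subseteq> prime_filters L" using C(2) by (auto simp: B_def prime_chains_iff)
      moreover have "y \<subseteq> z \<or> z \<subseteq> y" if "y \<in> B" "z \<in> B" for y z
        using prime_chains_linear[OF C(2), of y z] that by (simp add: B_def)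
      ultimately have "chain_below F T x" by (intro chain_belowI[of B]) (simp_all add: T_def)
      then show ?thesis using c(2)[OF T prime_chains_filter[OF D(1) x]] by simp
    qed
    then have "c T \<in> x" if x: "x \<in> D'" for x
    proof -
      have "x \<inter> F' \<in> trace F' D" unfolding D(3) by (rule traceI[OF x])
      then obtain y where "y \<in> D" "x \<inter> F' = y \<inter> F'" by (rule traceE)
      moreover have "c T \<in> F'" using T by (auto simp: F'_def)
      ultimately show ?thesis using \<open>\<And>x. x \<in> D \<Longrightarrow> c T \<in> x\<close> by blast
    qed
    then have "c T \<in> \<Inter>D'" by blast
    \<comment> \<open>\<open>D'\<close> may lack a least member; its intersection is the prime below
      which the new lower part is found.\<close>
    moreover have I: "\<Inter>D' \<in> prime_filters L"
      using D(2) by (intro Inter_chain_prime) (simp_all add: prime_chains_iff)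
    ultimately have "chain_below F T (\<Inter>D')" using c(2)[OF T I] by simp
    then obtain B' where B0: "B' \<subseteq> prime_filters L" "\<forall>y \<in> B'. \<forall>z \<in> B'. y \<subseteq> z \<or> z \<subseteq> y"
      "\<forall>y \<in> B'. y \<subseteq> \<Inter>D'" "trace F B' = T"
      unfolding chain_below_def by blast
    note B' = B0(1) B0(2,3)[rule_format] B0(4)
    define C' where "C' = B' \<union> D'"
    have C': "C' \<in> prime_chains L"
      unfolding prime_chains_iff
    proof (intro conjI ballI)
      show "C' \<subseteq> prime_filters L" "C' \<noteq> {}"
        using B'(1) D(2) by (auto simp: C'_def prime_chains_iff)
      fix w z assume "w \<in> C'" "z \<in> C'"
      then consider "w \<in> B'" "z \<in> B'" | "w \<in> B'" "z \<in> D'" | "w \<in> D'" "z \<in> B'" | "w \<in> D'" "z \<in> D'"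
        unfolding C'_def by blast
      then show "w \<subseteq> z \<or> z \<subseteq> w"
        by cases (use B'(2)[of w z] B'(3)[of w] B'(3)[of z] prime_chains_linear[OF D(2), of w z] in blast)+
    qed
    have "segment C' D'"
      unfolding segment_def
    proof (intro conjI ballI impI)
      fix x y assume xy: "x \<in> D'" "y \<in> C'" "x \<subseteq> y"
      show "y \<in> D'"
      \<comment> \<open>\<open>B'\<close> and \<open>D'\<close> may overlap: a member
        \<open>y\<close> of \<open>B'\<close> with \<open>x \<subseteq> y\<close> satisfies
        \<open>y \<subseteq> \<Inter>D' \<subseteq> x\<close>, so \<open>y = x\<close>.\<close>
      proof (cases "y \<in> B'")
        case True
        then have "y = x" using B'(3)[OF True] xy by blast
        then show ?thesis using xy by simp
      qed (use xy in \<open>simp add: C'_def\<close>)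
    qed (simp add: C'_def)
    moreover have "trace F C = trace F C'"
    proof -
      have "trace F C = trace F (B \<union> D)" using DC by (simp add: B_def Un_absorb2)
      also have "\<dots> = trace F C'"
        unfolding C'_def trace_Un B'(4) T_def trace_mono[OF F'(3) D(3)] ..
      finally show ?thesis .
    qed
    ultimately show ?thesis using W C C' unfolding determined_def by blast
  qed
  then have "determined L F' {D \<in> prime_chains L. \<exists>C \<in> W. C \<in> prime_chains L \<and> segment C D}"
    unfolding determined_def by blast
  then show ?thesis using F' by blast
qed

text \<open>An up-set containing \<open>W - V\<close> contains all segments of its chains, so
  \<open>R\<close> is least among the up-sets \<open>S\<close> with
  \<open>W \<subseteq> V \<union> S\<close>. Finite support of \<open>R\<close> comes from
  \<open>segment_closure_determined\<close>.\<close>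

lemma chain_algebra_co_heytingI:
  assumes co: "co_heyting_algebra L"
  shows "co_heyting_algebra (chain_algebra L)"
proof -
  interpret A: godel_algebra "chain_algebra L" by (rule chain_algebra_godel(1))
  interpret A: bounded_distributive_lattice "chain_algebra L" by (rule A.bounded_distributive)
  interpret chains: forest "prime_chains L" segment by (rule prime_chains_forest)
  show ?thesis
    unfolding A.co_heyting_iff
  proof (intro ballI)
    fix V W assume V: "V \<in> carrier (chain_algebra L)" and W: "W \<in> carrier (chain_algebra L)"
    define R where "R = {D \<in> prime_chains L. \<exists>C \<in> W - V. C \<in> prime_chains L \<and> segment C D}"
    have WX: "W \<subseteq> prime_chains L" using chain_algebra_sub[OF W] by (simp add: upsets_carrier)
    obtain F where F: "finite F" "F \<subseteq> carrier L" "determined L F V" "determined L F W"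
      using common_support[OF V W] by blast
    have "D \<notin> V" if "C \<in> prime_chains L" "D \<in> prime_chains L" "trace F C = trace F D" "C \<notin> V" for C D
      using F(3) that(1,2,4) that(3)[symmetric] unfolding determined_def by blast
    then have "determined L F (W - V)"
      using F(4) unfolding determined_def by blast
    from segment_closure_determined[OF co F(1,2) this]
    obtain F' where F': "finite F'" "F' \<subseteq> carrier L" "determined L F' R"
      unfolding R_def by blast
    have "E \<in> R" if D: "D \<in> R" and E: "E \<in> prime_chains L" "segment D E" for D E
    proof -
      obtain C where C: "D \<in> prime_chains L" "C \<in> W - V" "C \<in> prime_chains L" "segment C D"
        using D unfolding R_def by blast
      have "segment C E" using chains.trans[OF C(3,1) E(1) C(4) E(2)] .
      then show ?thesis using C E(1) unfolding R_def by blast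
    qed
    then have "R \<in> carrier chains.U" unfolding upsets_carrier by (auto simp: R_def)
    then have R: "R \<in> carrier (chain_algebra L)"
      using F' unfolding chain_algebra_carrier by blast
    have "W - V \<subseteq> R" using WX chains.refl unfolding R_def by blast
    then have WR: "W \<subseteq> V \<union> R" by blast
    have least: "R \<subseteq> S" if S: "S \<in> carrier (chain_algebra L)" and WS: "W \<subseteq> V \<union> S" for S
    proof
      fix D assume "D \<in> R"
      then obtain C where C: "D \<in> prime_chains L" "C \<in> W - V" "segment C D" unfolding R_def by blast
      then have "C \<in> S" using WS by blast
      then show "D \<in> S" using chain_algebra_sub[OF S] C unfolding upsets_carrier by blast
    qed
    have "least (chain_algebra L) R {S \<in> carrier (chain_algebra L). W \<subseteq> V \<union> S}"
      unfolding least_def chain_algebra_le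
      using R WR least by (intro conjI ballI) blast+
    moreover have "{S \<in> carrier (chain_algebra L). W \<subseteq> V \<union> S} =
        {S \<in> carrier (chain_algebra L). W \<sqsubseteq>\<^bsub>chain_algebra L\<^esub> V \<squnion>\<^bsub>chain_algebra L\<^esub> S}"
      using chain_algebra_ops(2)[OF V] by (intro Collect_cong conj_cong) simp_all
    ultimately show "\<exists>R. least (chain_algebra L) R
        {S \<in> carrier (chain_algebra L). W \<sqsubseteq>\<^bsub>chain_algebra L\<^esub> V \<squnion>\<^bsub>chain_algebra L\<^esub> S}"
      by auto
  qed
qed

section \<open>From the chain algebra back to co-implications in \<open>L\<close>\<close>

lemma exclude_trace:
  assumes I: "I \<subseteq> carrier L" "\<top> \<in> I" "\<And>c d. \<lbrakk>c \<in> I; d \<in> I\<rbrakk> \<Longrightarrow> c \<sqinter> d \<in> I"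
    and F: "finite F" "F \<subseteq> carrier L" and s: "s \<subseteq> F"
    and none: "\<And>y. \<lbrakk>y \<in> prime_filters L; I \<subseteq> y\<rbrakk> \<Longrightarrow> y \<inter> F \<noteq> s"
  shows "\<exists>c \<in> I. \<forall>p \<in> prime_filters L. c \<in> p \<longrightarrow> p \<inter> F \<noteq> s"
proof (rule ccontr)
  \<comment> \<open>A compactness argument: if every \<open>c \<in> I\<close> lies in some prime
    with trace \<open>s\<close>, then \<open>j\<close>, the join of \<open>F - s\<close>, is not in
    the filter generated by \<open>I\<close> and \<open>s\<close>. A prime extending this filter and
    omitting \<open>j\<close> contains \<open>I\<close> and has trace exactly
    \<open>s\<close>.\<close>
  assume neg: "\<not> ?thesis"
  obtain j where j: "j \<in> carrier L" "\<And>p. p \<in> prime_filters L \<Longrightarrow> j \<in> p \<longleftrightarrow> (F - s) \<inter> p \<noteq> {}"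
    using finite_join_exists[OF finite_Diff[OF F(1)] subset_trans[OF Diff_subset F(2)], of s] by blast
  \<comment> \<open>The filter generated by \<open>I\<close> and \<open>s\<close>, described through
    primes: \<open>w\<close> lies above the meet of some \<open>c \<in> I\<close> with all elements
    of \<open>s\<close>.\<close>
  define A where "A = {w \<in> carrier L. \<exists>c \<in> I. \<forall>p \<in> prime_filters L. c \<in> p \<and> s \<subseteq> p \<longrightarrow> w \<in> p}"
  have AI: "w \<in> A" if "w \<in> carrier L" "c \<in> I" "\<And>p. \<lbrakk>p \<in> prime_filters L; c \<in> p; s \<subseteq> p\<rbrakk> \<Longrightarrow> w \<in> p" for w c
    using that unfolding A_def by blast
  have "\<exists>p \<in> prime_filters L. A \<subseteq> p \<and> j \<notin> p"
  proof (rule prime_between)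
    show "A \<subseteq> carrier L" by (auto simp: A_def)
    have "\<top> \<in> A" by (rule AI[OF top_closed I(2)]) simp
    then show "A \<noteq> {}" by blast
    show "j \<in> carrier L" by (rule j(1))
  next
    fix v w assume "v \<in> A" "w \<in> A"
    then obtain c d where c: "v \<in> carrier L" "w \<in> carrier L" "c \<in> I" "d \<in> I"
      "\<forall>p \<in> prime_filters L. c \<in> p \<and> s \<subseteq> p \<longrightarrow> v \<in> p" "\<forall>p \<in> prime_filters L. d \<in> p \<and> s \<subseteq> p \<longrightarrow> w \<in> p"
      unfolding A_def by blast
    have cd: "c \<in> carrier L" "d \<in> carrier L" using c I(1) by blast+
    show "v \<sqinter> w \<in> A"
    proof (rule AI[OF meet_closed[OF c(1,2)] I(3)[OF c(3,4)]])
      fix p assume "p \<in> prime_filters L" "c \<sqinter> d \<in> p" "s \<subseteq> p"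
      then show "v \<sqinter> w \<in> p" using c cd by simp
    qed
  next
    fix w assume "w \<in> A"
    then obtain c where c: "w \<in> carrier L" "c \<in> I" "\<forall>p \<in> prime_filters L. c \<in> p \<and> s \<subseteq> p \<longrightarrow> w \<in> p"
      unfolding A_def by blast
    obtain p where p: "p \<in> prime_filters L" "c \<in> p" "p \<inter> F = s" using neg c(2) by blast
    then have "w \<in> p" "j \<notin> p" using c(3) j(2)[OF p(1)] by blast+
    then show "\<not> w \<sqsubseteq> j" using prime_filters_up[OF p(1) _ _ j(1)] by blast
  qed
  then obtain p where p: "p \<in> prime_filters L" "A \<subseteq> p" "j \<notin> p" by blast
  have "c \<in> p" if c: "c \<in> I" for c
    using subsetD[OF p(2) AI[of c c]] c I(1) by blast
  moreover have "f \<in> p" if f: "f \<in> s" for f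
    using subsetD[OF p(2) AI[of f \<top>]] f I(2) s F(2) by blast
  then have "p \<inter> F = s" using j(2)[OF p(1)] p(3) s by blast
  ultimately show False using none[OF p(1)] by blast
qed

text \<open>The one-element chains in the co-implication \<open>R\<close> of the units are the
  primes containing the filter \<open>I\<close>. Finite support of \<open>R\<close> thus makes
  containing \<open>I\<close> a matter of the trace on \<open>F\<close>. Each of the finitely many
  other traces is excluded by one element of \<open>I\<close>, and the meet of these elements is the
  least element of \<open>I\<close>.\<close>

lemma chain_algebra_co_heytingD:
  assumes co: "co_heyting_algebra (chain_algebra L)"
  shows "co_heyting_algebra L"
proof -
  interpret A: godel_algebra "chain_algebra L" by (rule chain_algebra_godel(1))
  interpret A: bounded_distributive_lattice "chain_algebra L" by (rule A.bounded_distributive)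
  show ?thesis
    unfolding co_heyting_iff
  proof (intro ballI)
    fix a b assume ab: "a \<in> carrier L" "b \<in> carrier L"
    define I where "I = {c \<in> carrier L. b \<sqsubseteq> a \<squnion> c}"
    have I_iff: "c \<in> I \<longleftrightarrow> (\<forall>p \<in> prime_filters L. b \<in> p \<longrightarrow> a \<in> p \<or> c \<in> p)" if "c \<in> carrier L" for c
      using le_join_iff_prime[OF ab that] that by (simp add: I_def)
    have Ic: "I \<subseteq> carrier L" by (auto simp: I_def)
    have Itop: "\<top> \<in> I" by (simp add: I_iff)
    have Imeet: "c \<sqinter> d \<in> I" if "c \<in> I" "d \<in> I" for c d
    proof -
      have cd: "c \<in> carrier L" "d \<in> carrier L" using that Ic by blast+
      show ?thesis
        unfolding I_iff[OF meet_closed[OF cd]]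
        using that cd unfolding I_iff[OF cd(1)] I_iff[OF cd(2)] by auto
    qed
    note u = chain_unit_closed[of _ L]
    obtain R where R: "least (chain_algebra L) R {S \<in> carrier (chain_algebra L).
        chain_unit L b \<sqsubseteq>\<^bsub>chain_algebra L\<^esub> chain_unit L a \<squnion>\<^bsub>chain_algebra L\<^esub> S}"
      using co u[OF ab(1)] u[OF ab(2)] unfolding A.co_heyting_iff by blast
    have Rc: "R \<in> carrier (chain_algebra L)" using R by (rule least_closed)
    have Rb: "chain_unit L b \<subseteq> chain_unit L a \<union> R"
      using least_mem[OF R] chain_algebra_ops(2)[OF u[OF ab(1)] Rc] by simp
    have Rleast: "R \<subseteq> S" if S: "S \<in> carrier (chain_algebra L)" "chain_unit L b \<subseteq> chain_unit L a \<union> S" for S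
      using least_le[OF R, of S] S chain_algebra_ops(2)[OF u[OF ab(1)] S(1)] by simp
    have R_iff: "{y} \<in> R \<longleftrightarrow> I \<subseteq> y" if y: "y \<in> prime_filters L" for y
    proof
      assume yR: "{y} \<in> R"
      show "I \<subseteq> y"
      proof
        fix c assume c: "c \<in> I"
        then have cc: "c \<in> carrier L" using Ic by blast
        \<comment> \<open>The inequality \<open>b \<sqsubseteq> a \<squnion> c\<close> passes to the
          units, so leastness puts \<open>R\<close> inside \<open>chain_unit L c\<close>.\<close>
        have "b \<in> x \<longrightarrow> a \<squnion> c \<in> x" if "x \<in> prime_filters L" for x
          using c that cc ab unfolding I_iff[OF cc] by simp
        then have "chain_unit L b \<subseteq> chain_unit L (a \<squnion> c)"
          unfolding chain_unit_def using prime_chains_filter by blast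
        then have "R \<subseteq> chain_unit L c"
          using Rleast[OF u[OF cc]] chain_unit_join[OF ab(1) cc] by simp
        then show "c \<in> y" using yR by (auto simp: chain_unit_def)
      qed
    next
      assume Iy: "I \<subseteq> y"
      have "\<exists>x \<in> prime_filters L. x \<subseteq> y \<and> b \<in> x \<and> a \<notin> x"
        by (rule prime_below[OF y ab]) (use Iy in \<open>auto simp: I_def\<close>)
      then obtain x where x: "x \<in> prime_filters L" "x \<subseteq> y" "b \<in> x" "a \<notin> x" by blast
      \<comment> \<open>This chain is in the unit of \<open>b\<close> but not in that of
        \<open>a\<close>, hence in \<open>R\<close>, and \<open>{y}\<close> is a segment of
        it.\<close>
      have "{x, y} \<in> prime_chains L" using x y by (simp add: prime_chains_iff)
      then have "{x, y} \<in> chain_unit L b" "{x, y} \<notin> chain_unit L a"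
        using x by (auto simp: chain_unit_def)
      then have "{x, y} \<in> R" using Rb by blast
      moreover have "segment {x, y} {y}" using x(2) by (auto simp: segment_def)
      ultimately show "{y} \<in> R"
        using chain_algebra_sub[OF Rc] prime_chains_singleton[OF y] unfolding upsets_carrier by blast
    qed
    obtain F where F: "finite F" "F \<subseteq> carrier L" "determined L F R"
      using Rc unfolding chain_algebra_carrier by blast
    have transfer: "I \<subseteq> z" if y: "y \<in> prime_filters L" "I \<subseteq> y" and z: "z \<in> prime_filters L" "y \<inter> F = z \<inter> F" for y z
    proof -
      have "trace F {y} = trace F {z}" using z(2) by (simp add: trace_def)
      moreover have "{y} \<in> R" using R_iff y by simp
      ultimately have "{z} \<in> R"
        using F(3) prime_chains_singleton[OF y(1)] prime_chains_singleton[OF z(1)]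
        unfolding determined_def by blast
      then show ?thesis using R_iff z(1) by simp
    qed
    \<comment> \<open>The subsets of \<open>F\<close> that are not the trace of a prime containing
      \<open>I\<close>.\<close>
    define bad where "bad = {s \<in> Pow F. \<forall>y \<in> prime_filters L. I \<subseteq> y \<longrightarrow> y \<inter> F \<noteq> s}"
    have "\<forall>s \<in> bad. \<exists>c. c \<in> I \<and> (\<forall>p \<in> prime_filters L. c \<in> p \<longrightarrow> p \<inter> F \<noteq> s)"
    proof
      fix s assume "s \<in> bad"
      then have s: "s \<subseteq> F" "\<And>y. \<lbrakk>y \<in> prime_filters L; I \<subseteq> y\<rbrakk> \<Longrightarrow> y \<inter> F \<noteq> s"
        by (simp_all add: bad_def)
      have "\<exists>c \<in> I. \<forall>p \<in> prime_filters L. c \<in> p \<longrightarrow> p \<inter> F \<noteq> s"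
        by (rule exclude_trace[OF Ic Itop Imeet F(1,2) s(1) s(2)])
      then show "\<exists>c. c \<in> I \<and> (\<forall>p \<in> prime_filters L. c \<in> p \<longrightarrow> p \<inter> F \<noteq> s)"
        by (elim bexE) (intro exI conjI)
    qed
    from bchoice[OF this] obtain c where
      c': "\<forall>s \<in> bad. c s \<in> I \<and> (\<forall>p \<in> prime_filters L. c s \<in> p \<longrightarrow> p \<inter> F \<noteq> s)" by (elim exE)
    have c: "c s \<in> I" "\<And>p. \<lbrakk>p \<in> prime_filters L; c s \<in> p\<rbrakk> \<Longrightarrow> p \<inter> F \<noteq> s" if "s \<in> bad" for s
      using bspec[OF c' that] by simp_all
    have "bad \<subseteq> Pow F" by (auto simp: bad_def)
    then have "finite bad" by (rule finite_subset) (simp add: F(1))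
    then have "finite (c ` bad)" by (rule finite_imageI)
    moreover have "c ` bad \<subseteq> carrier L" using subsetD[OF Ic c(1)] by (rule image_subsetI)
    ultimately have "\<exists>m \<in> carrier L. \<forall>p \<in> prime_filters L. m \<in> p \<longleftrightarrow> c ` bad \<subseteq> p"
      by (rule finite_meet_exists)
    then obtain d where d': "d \<in> carrier L" "\<forall>p \<in> prime_filters L. d \<in> p \<longleftrightarrow> c ` bad \<subseteq> p"
      by (elim bexE) (rule that)
    note d = d'(1) bspec[OF d'(2)]
    have "a \<in> p \<or> d \<in> p" if p: "p \<in> prime_filters L" "b \<in> p" for p
    proof -
      have "c s \<in> p" if "s \<in> bad" "a \<notin> p" for s
        using c(1)[OF that(1)] I_iff[OF subsetD[OF Ic c(1)[OF that(1)]]] p that(2) by blast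
      then show ?thesis unfolding d(2)[OF p(1)] by blast
    qed
    then have dI: "d \<in> I" unfolding I_iff[OF d(1)] by blast
    have "d \<sqsubseteq> w" if w: "w \<in> I" for w
    proof -
      have wc: "w \<in> carrier L" using w Ic by blast
      have "w \<in> z" if z: "z \<in> prime_filters L" "d \<in> z" for z
      proof -
        \<comment> \<open>As \<open>d \<in> z\<close>, all excluding elements lie in
          \<open>z\<close>; so \<open>z\<close> has the trace of a prime containing
          \<open>I\<close>, and \<open>transfer\<close> gives
          \<open>I \<subseteq> z\<close>.\<close>
        have "z \<inter> F \<notin> bad" using c(2)[of "z \<inter> F", OF _ z(1)] d(2)[OF z(1)] z by blast
        then obtain y where "y \<in> prime_filters L" "I \<subseteq> y" "y \<inter> F = z \<inter> F" unfolding bad_def by blast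
        from transfer[OF this(1,2) z(1) this(3)] w show ?thesis by (rule subsetD)
      qed
      then show ?thesis unfolding le_iff_prime[OF d(1) wc] by blast
    qed
    then have "least L d I" unfolding least_def using dI Ic by (intro conjI ballI)
    then show "\<exists>z. least L z {w \<in> carrier L. b \<sqsubseteq> a \<squnion> w}" unfolding I_def by (rule exI)
  qed
qed

end

theorem theorem5p7:
  fixes L :: "'l gorder" and G :: "'g gorder" and e :: "'l \<Rightarrow> 'g"
  assumes "bounded_distributive_lattice L"
    and "free_godel_algebra L G e"
  shows "bi_heyting_algebra G \<longleftrightarrow> co_heyting_algebra L"
proof -
  interpret L: bounded_distributive_lattice L by fact
  interpret G: godel_algebra G using assms(2) by (simp add: free_godel_algebra_def)
  interpret A: godel_algebra "chain_algebra L" by (rule chain_algebra_godel(1))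
  obtain g where g: "g ` carrier G = carrier (chain_algebra L)"
    "\<forall>u \<in> carrier G. \<forall>v \<in> carrier G. u \<sqsubseteq>\<^bsub>G\<^esub> v \<longleftrightarrow> g u \<subseteq> g v"
    using free_godel_chain_algebra[OF assms] by (elim exE conjE) (rule that)
  have "bi_heyting_algebra G \<longleftrightarrow> co_heyting_algebra G" by (rule G.bi_heyting_iff)
  also have "\<dots> \<longleftrightarrow> co_heyting_algebra (chain_algebra L)"
    by (rule co_heyting_order_iso[OF G.bounded_distributive A.bounded_distributive g(1)]) (simp add: g(2)[rule_format])
  also have "\<dots> \<longleftrightarrow> co_heyting_algebra L"
    by (rule iffI) (rule L.chain_algebra_co_heytingD, assumption, rule L.chain_algebra_co_heytingI)
  finally show ?thesis .
qed

end
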